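(* Let $\mathcal{P}\subset\mathbb{N}$ be the set of prime numbers. Every increasing sequence of positive integers has a subsequence along which $\mathcal{P}$ has doubly metric Poissonian pair correlations.
   Context: $\mathbb{N}=\{1,2,3,\dots\}$, $\mathbb{T}=\mathbb{R}/\mathbb{Z}$, $\|\cdot\|$ denotes distance to $0$ in $\mathbb{T}$, and $[N]=\{1,\dots,N\}$. For an infinite set $\mathcal{A}\subset\mathbb{N}$, enumerate its elements in increasing order as $a_1<a_2<\cdots$. For $\alpha,\gamma\in\mathbb{T}$, $s>0$, $N\in\mathbb{N}$, define $$F(\alpha,\gamma,s,N,\mathcal{A})=\frac1N\#\Big\{(i,j)\in[N]\times[N] : i\neq j,\ \|a_i\alpha-a_j\alpha-\gamma\|\le \frac sN\Big\}.$$ For an increasing sequence $\{M_t\}\subset\mathbb{N}$, the set $\mathcal{A}$ has doubly metric Poissonian pair correlations along $\{M_t\}$ if for Lebesgue-almost every pair $(\alpha,\gamma)\in\mathbb{T}^2$ one has $\lim_{t\to\infty}F(\alpha,\gamma,s,M_t,\mathcal{A})=2s$ for every real $s>0$. *)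

theory Defs
  imports "HOL-Analysis.Analysis" "HOL-Computational_Algebra.Primes"
begin

text \<open>
  Elements of the circle \<open>\<real>/\<int>\<close> are given by real representatives; all notions below
  depend only on the classes modulo 1.
\<close>

definition circle_norm :: "real \<Rightarrow> real" where
  "circle_norm x = infdist x \<int>"

text \<open>
  The library function \<open>enumerate\<close> counts from 0. It is the increasing enumeration for
  infinite \<open>A\<close> only; the definitions below are meant for such \<open>A\<close>.
\<close>

definition nth_elem :: "nat set \<Rightarrow> nat \<Rightarrow> nat" where
  "nth_elem A i = enumerate A (i - 1)"

definition pair_corr :: "real \<Rightarrow> real \<Rightarrow> real \<Rightarrow> nat \<Rightarrow> nat set \<Rightarrow> real" where
  "pair_corr \<alpha> \<gamma> s N A =
     1 / real N * real (card {(i, j). i \<in> {1..N} \<and> j \<in> {1..N} \<and> i \<noteq> j \<and>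
       circle_norm (real (nth_elem A i) * \<alpha> - real (nth_elem A j) * \<alpha> - \<gamma>) \<le> s / real N})"

text \<open>
  The measure on the two-dimensional torus is Lebesgue measure on the fundamental domain
  \<open>[0,1) \<times> [0,1)\<close>.
\<close>

definition doubly_metric_poissonian_along :: "nat set \<Rightarrow> (nat \<Rightarrow> nat) \<Rightarrow> bool" where
  "doubly_metric_poissonian_along A M \<longleftrightarrow>
     (AE (\<alpha>, \<gamma>) in lebesgue_on ({0..<1} \<times> {0..<1}).
        \<forall>s>0. (\<lambda>t. pair_corr \<alpha> \<gamma> s (M t) A) \<longlonglongrightarrow> 2 * s)"

end

theory Submission
  imports Defs "HOL-Computational_Algebra.Squarefree" "HOL-Number_Theory.Cong"
    "HOL-Real_Asymp.Real_Asymp"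
begin

text \<open>
  If \<open>m \<noteq> m'\<close>, the events \<open>\<parallel>m \<alpha> - \<gamma>\<parallel> \<le> \<delta>\<close> and \<open>\<parallel>m' \<alpha> - \<gamma>\<parallel> \<le> \<delta>\<close>
  are independent on the torus, so the second moment of \<open>F - 2s\<close> is at most
  \<open>2s E / N^3 + 4s^2 / N^2\<close>, where \<open>E\<close> counts the coincidences among the differences
  \<open>a\<^sub>i - a\<^sub>j\<close> with \<open>i \<noteq> j\<close>. If \<open>E = o(N^3)\<close>, then along a sparse subsequence these moments
  are summable for every \<open>s\<close>, which gives convergence almost everywhere for all rational \<open>s\<close>, and then
  for all \<open>s\<close> by monotonicity.

  For the primes, \<open>E\<close> is at most \<open>N^2\<close> times the largest number of pairs of primes up to
  \<open>x = p\<^sub>N\<close> with a prescribed nonzero difference \<open>d\<close>. Brun's pure sieve with the primes below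
  \<open>exp ((ln x) powr (2/3))\<close> that do not divide \<open>d\<close> bounds this number by
  \<open>x / (ln x) powr (4/3)\<close> up to powers of \<open>ln (ln x)\<close>, uniformly in \<open>d\<close>, and this is
  \<open>o(N)\<close> by Chebyshev's lower bound.
\<close>

section \<open>Elementary estimates for primes\<close>

text \<open>Legendre's formula, by induction: passing from \<open>n\<close> to \<open>n + 1\<close>
  raises \<open>n div p ^ i\<close> by one exactly when \<open>p ^ i\<close> divides
  \<open>n + 1\<close>. The free cut-off \<open>T\<close> lets the sums for \<open>n\<close> and
  \<open>2 * n\<close> share one index range.\<close>

lemma multiplicity_fact_eq_sum:
  fixes p :: nat
  assumes p: "prime p" and "n \<le> T"
  shows "multiplicity p (fact n) = (\<Sum>i=1..T. n div p ^ i)"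
  using \<open>n \<le> T\<close>
proof (induction n)
  case 0
  then show ?case by simp
next
  case (Suc n)
  have step: "Suc n div p ^ i = n div p ^ i + (if p ^ i dvd Suc n then 1 else 0)" for i
    using p by (simp add: div_Suc mod_eq_0_iff_dvd)
  have p1: "p > 1" using p prime_gt_1_nat by blast
  have nu: "\<not> is_unit p" using p1 by simp
  have lt: "i < p ^ i" for i using p1 by (simp add: power_gt_expt)
  have "multiplicity p (Suc n) \<le> T"
  proof -
    have "p ^ multiplicity p (Suc n) \<le> Suc n" by (intro dvd_imp_le multiplicity_dvd) auto
    then show ?thesis using lt[of "multiplicity p (Suc n)"] Suc.prems by linarith
  qed
  moreover have dvd_iff: "p ^ i dvd Suc n \<longleftrightarrow> i \<le> multiplicity p (Suc n)" for i
    using p nu by (intro power_dvd_iff_le_multiplicity) simp_all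
  ultimately have "{i \<in> {1..T}. p ^ i dvd Suc n} = {1..multiplicity p (Suc n)}"
    by (simp only: set_eq_iff mem_Collect_eq atLeastAtMost_iff dvd_iff) linarith
  then have "(\<Sum>i=1..T. if p ^ i dvd Suc n then 1 else 0) = multiplicity p (Suc n)"
    by (simp flip: sum.inter_filter)
  moreover have "multiplicity p (fact (Suc n)) = multiplicity p (Suc n) + multiplicity p (fact n)"
    unfolding fact_Suc of_nat_id
    by (rule prime_elem_multiplicity_mult_distrib) (use p in auto)
  ultimately show ?case
    using Suc by (simp add: step sum.distrib)
qed

text \<open>By Legendre's formula each \<open>i\<close> contributes
  \<open>(2 * n) div p ^ i - 2 * (n div p ^ i)\<close>, which is 0 or 1 and vanishes once
  \<open>p ^ i > 2 * n\<close>. If \<open>p ^ k\<close> exceeded \<open>2 * n\<close>, at most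
  \<open>k - 1\<close> values of \<open>i\<close> would contribute to the multiplicity
  \<open>k\<close>.\<close>

lemma prime_power_central_binomial_le:
  fixes p n :: nat
  assumes p: "prime p" and n: "n > 0"
  shows "p ^ multiplicity p ((2 * n) choose n) \<le> 2 * n"
proof (rule ccontr)
  define k where "k = multiplicity p ((2 * n) choose n)"
  assume "\<not> ?thesis"
  then have big: "p ^ k > 2 * n" by (simp add: k_def)
  have p1: "p > 1" using p prime_gt_1_nat by blast
  have k0: "k > 0" using big n by (cases k) auto
  have "multiplicity p (fact (2 * n) :: nat) = multiplicity p (fact n * fact n * ((2 * n) choose n))"
    using binomial_fact_lemma[of n "2 * n"] by simp
  also have "\<dots> = 2 * multiplicity p (fact n :: nat) + k"
    unfolding k_def using p n by (simp add: prime_elem_multiplicity_mult_distrib)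
  finally have "k = (\<Sum>i=1..2*n. (2 * n) div p ^ i) - 2 * (\<Sum>i=1..2*n. n div p ^ i)"
    using multiplicity_fact_eq_sum[OF p, of n "2 * n"] multiplicity_fact_eq_sum[OF p, of "2 * n" "2 * n"]
    by simp
  also have "\<dots> \<le> (\<Sum>i=1..2*n. if i < k then 1 else 0)"
  proof -
    have "(2 * n) div p ^ i \<le> 2 * (n div p ^ i) + (if i < k then 1 else 0)" for i
    proof (cases "i < k")
      case True
      define q where "q = p ^ i"
      have "q > 0" using p1 by (simp add: q_def)
      have "n < q * (n div q + 1)" using \<open>q > 0\<close>
        by (metis Suc_eq_plus1 dividend_less_times_div mult_Suc_right add.commute)
      then have "2 * n < q * (2 * (n div q) + 2)" by (simp add: algebra_simps)
      then have "2 * n div q < 2 * (n div q) + 2"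
        using \<open>q > 0\<close> by (simp add: div_less_iff_less_mult mult.commute)
      then show ?thesis using True by (simp add: q_def)
    next
      case False
      then have "p ^ k \<le> p ^ i" using p1 by (intro power_increasing) auto
      then show ?thesis using big by simp
    qed
    then have "(\<Sum>i=1..2*n. (2 * n) div p ^ i)
        \<le> (\<Sum>i=1..2*n. 2 * (n div p ^ i) + (if i < k then 1 else 0))"
      by (intro sum_mono)
    then show ?thesis by (simp add: sum.distrib sum_distrib_left)
  qed
  also have "\<dots> = card {i \<in> {1..2*n}. i < k}" by (simp flip: sum.inter_filter)
  also have "\<dots> \<le> card {1..<k}" by (intro card_mono) auto
  also have "\<dots> < k" using k0 by simp
  finally show False by simp
qed

lemma primes_upto_finite [simp]: "finite {p :: nat. prime p \<and> p \<le> n}"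
  by (rule finite_subset[of _ "{..n}"]) auto

lemma central_binomial_le_power_card_primes:
  assumes "n > 0"
  shows "(2 * n) choose n \<le> (2 * n) ^ card {p :: nat. prime p \<and> p \<le> 2 * n}"
proof -
  let ?B = "(2 * n) choose n"
  have B: "?B \<noteq> 0" by simp
  have "?B = (\<Prod>p\<in>prime_factors ?B. p ^ multiplicity p ?B)"
    using prime_factorization_nat[of ?B] B by simp
  also have "\<dots> \<le> (\<Prod>p\<in>prime_factors ?B. 2 * n)"
    using assms by (intro prod_mono) (auto intro: prime_power_central_binomial_le)
  also have "\<dots> = (2 * n) ^ card (prime_factors ?B)" by simp
  also have "\<dots> \<le> (2 * n) ^ card {p :: nat. prime p \<and> p \<le> 2 * n}"
  proof (intro power_increasing card_mono subsetI)
    fix p assume p: "p \<in> prime_factors ?B"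
    then have "prime p" "p dvd fact (2 * n)"
      using binomial_fact_lemma[of n "2 * n"] by (metis dvd_mult in_prime_factors_iff le_add1 mult_2)+
    then show "p \<in> {p. prime p \<and> p \<le> 2 * n}"
      by (simp add: prime_dvd_fact_iff)
  qed (use assms in auto)
  finally show ?thesis .
qed

text \<open>Chebyshev's lower bound: for \<open>n = x div 2\<close> the central binomial coefficient
  lies between \<open>4 ^ n / (2 * n)\<close> and \<open>x ^ k\<close>, and logarithms are
  compared.\<close>

lemma card_primes_ge:
  "\<forall>\<^sub>F x in sequentially. real x / (8 * ln (real x)) \<le> real (card {p :: nat. prime p \<and> p \<le> x})"
proof -
  have "\<forall>\<^sub>F x :: nat in sequentially. x \<ge> 2" by (rule eventually_ge_at_top)
  \<comment> \<open>The constant 8 is generous; it absorbs the rounding in \<open>x div 2\<close>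
    and the factor \<open>2 * n\<close>.\<close>
  moreover have "\<forall>\<^sub>F x :: nat in sequentially. real x / 8 \<le> (real x / 2 - 1) - ln (real x)"
    by real_asymp
  ultimately show ?thesis
  proof eventually_elim
    case (elim x)
    define n where "n = x div 2"
    define k where "k = card {p :: nat. prime p \<and> p \<le> x}"
    have n: "n > 0" "2 * n \<le> x" "real n \<ge> real x / 2 - 1" using elim(1) unfolding n_def
      by (auto simp: real_of_nat_div)
    have k: "card {p :: nat. prime p \<and> p \<le> 2 * n} \<le> k"
      unfolding k_def using n by (intro card_mono) auto
    have "4 ^ n / (2 * real n) \<le> real ((2 * n) choose n)"
      by (rule central_binomial_lower_bound[OF n(1)])
    also have "\<dots> \<le> real ((2 * n) ^ card {p :: nat. prime p \<and> p \<le> 2 * n})"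
      using central_binomial_le_power_card_primes[OF n(1)] by (simp only: of_nat_le_iff)
    also have "\<dots> \<le> real (x ^ k)"
    proof -
      have "(2 * n) ^ card {p :: nat. prime p \<and> p \<le> 2 * n} \<le> (2 * n) ^ k"
        using k n by (intro power_increasing) auto
      also have "\<dots> \<le> x ^ k" using n by (intro power_mono) auto
      finally show ?thesis by (simp only: of_nat_le_iff)
    qed
    finally have "4 ^ n \<le> 2 * real n * real x ^ k" using n by (simp add: field_simps)
    also have "\<dots> \<le> real x * real x ^ k" using n by (intro mult_right_mono) auto
    finally have "ln (4 ^ n) \<le> ln (real x * real x ^ k)"
      using n by (subst ln_le_cancel_iff) auto
    then have "real n * ln 4 \<le> ln (real x) + real k * ln (real x)"
      using n by (simp add: ln_mult ln_realpow)
    moreover have "ln (4 :: real) \<ge> 1"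
      using ln2_ge_two_thirds ln_realpow[of "2 :: real" 2] by simp
    then have "real n * 1 \<le> real n * ln 4"
      by (intro mult_left_mono) auto
    ultimately have "real x / 8 \<le> real k * ln (real x)" using elim(2) n by linarith
    then show ?case
      using elim(1) by (simp add: k_def field_simps)
  qed
qed

section \<open>Chebyshev's upper bound and sums of reciprocals of primes\<close>

lemma prod_primes_dvd:
  fixes n :: nat
  assumes "finite A" "\<And>p. p \<in> A \<Longrightarrow> prime p" "\<And>p. p \<in> A \<Longrightarrow> p dvd n"
  shows "\<Prod>A dvd n"
  using assms
proof (induction A)
  case (insert p A)
  have "coprime p (\<Prod>A)"
    using insert.prems insert.hyps by (intro prod_coprime_right) (metis insertCI primes_coprime)
  then show ?case
    using insert by (simp add: divides_mult)
qed simp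

text \<open>The product of these primes is at least \<open>n\<close> to the power of their number,
  and it divides \<open>(2 * n) choose n\<close>, which is at most \<open>4 ^ n\<close>.\<close>

lemma card_primes_dyadic_le:
  "card {p :: nat. prime p \<and> n < p \<and> p \<le> 2 * n} * ln (real n) \<le> real n * ln 4"
proof (cases "n = 0")
  case False
  let ?A = "{p :: nat. prime p \<and> n < p \<and> p \<le> 2 * n}"
  have fin: "finite ?A" by (rule finite_subset[of _ "{..2*n}"]) auto
  have "\<Prod>?A dvd (2 * n) choose n"
  proof (rule prod_primes_dvd[OF fin])
    fix p assume p: "p \<in> ?A"
    then have "p dvd fact n * fact n * ((2 * n) choose n)"
      using binomial_fact_lemma[of n "2 * n"] by (simp add: prime_dvd_fact_iff)
    moreover have "\<not> p dvd fact n" using p by (simp add: prime_dvd_fact_iff)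
    ultimately show "p dvd (2 * n) choose n"
      using p by (simp add: prime_dvd_mult_iff)
  qed auto
  then have "\<Prod>?A \<le> (2 * n) choose n" by (intro dvd_imp_le) auto
  also have "\<dots> \<le> 2 ^ (2 * n)" by (rule binomial_le_pow2)
  finally have "\<Prod>?A \<le> 4 ^ n" by (simp add: power_mult)
  moreover have "n ^ card ?A \<le> \<Prod>?A"
    using prod_mono[of ?A "\<lambda>_. n" "\<lambda>p. p"] by simp
  ultimately have "n ^ card ?A \<le> 4 ^ n" by linarith
  then have "real (n ^ card ?A) \<le> real (4 ^ n)" by (simp only: of_nat_le_iff)
  then have "ln (real n ^ card ?A) \<le> ln (4 ^ n)" using False by (subst ln_le_cancel_iff) auto
  then show ?thesis using False by (simp add: ln_realpow)
qed auto

text \<open>The primes in a dyadic block above \<open>2 ^ K\<close> number at most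
  \<open>2 * 2 ^ K / K\<close>, so they contribute at most \<open>2 / K\<close>; summing over blocks
  gives a harmonic number. The factor 2 lost against Mertens' theorem is harmless in the later
  applications.\<close>

lemma sum_inverse_primes_pow2_le:
  assumes "K \<ge> 1"
  shows "(\<Sum>p | prime p \<and> p \<le> 2 ^ K. 1 / real p) \<le> 2 * ln (real K) + 5 / 2"
proof -
  have "(\<Sum>p | prime p \<and> p \<le> 2 ^ K. 1 / real p) \<le> 1 / 2 + 2 * (harm (K - 1) :: real)"
    using assms
  proof (induction K rule: nat_induct_at_least)
    case base
    have "{p :: nat. prime p \<and> p \<le> 2 ^ 1} = {2}"
      by (auto intro: antisym dest: prime_ge_2_nat)
    then show ?case by (simp add: harm_def)
  next
    case (Suc K)
    let ?A = "{p :: nat. prime p \<and> 2 ^ K < p \<and> p \<le> 2 * 2 ^ K}"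
    have fin: "finite ?A" by (rule finite_subset[of _ "{..2 * 2 ^ K}"]) auto
    have eq: "{p :: nat. prime p \<and> p \<le> 2 ^ Suc K} = {p. prime p \<and> p \<le> 2 ^ K} \<union> ?A" by auto
    have "(\<Sum>p\<in>?A. 1 / real p) \<le> (\<Sum>p\<in>?A. 1 / 2 ^ K)"
    proof (rule sum_mono)
      fix p assume "p \<in> ?A"
      then have "real (2 ^ K) \<le> real p" by (simp only: of_nat_le_iff) simp
      then show "1 / real p \<le> 1 / 2 ^ K" using \<open>p \<in> ?A\<close> prime_gt_0_nat[of p]
        by (intro divide_left_mono) auto
    qed
    also have "\<dots> = card ?A / 2 ^ K" by simp
    also have "\<dots> \<le> 2 / real K"
    proof -
      have "ln (4 :: real) = 2 * ln 2" using ln_realpow[of "2 :: real" 2] by simp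
      then have "real (card ?A) * real K \<le> 2 ^ K * 2"
        using card_primes_dyadic_le[of "2 ^ K"] by (simp add: ln_realpow)
      then show ?thesis using Suc.hyps by (simp add: field_simps)
    qed
    finally have "(\<Sum>p\<in>?A. 1 / real p) \<le> 2 / real K" .
    moreover have "harm K = harm (K - 1) + 1 / real K"
      using harm_Suc[of "K - 1"] Suc.hyps by (simp add: field_simps)
    moreover have "(\<Sum>p | prime p \<and> p \<le> 2 ^ Suc K. 1 / real p)
       = (\<Sum>p | prime p \<and> p \<le> 2 ^ K. 1 / real p) + (\<Sum>p\<in>?A. 1 / real p)"
      unfolding eq using fin by (intro sum.union_disjoint) auto
    ultimately show ?case using Suc.IH by simp
  qed
  moreover have "(harm (K - 1) :: real) \<le> ln (real K) + 1"
  proof (cases "K = 1")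
    case False
    then obtain m where m: "K = Suc (Suc m)" using assms by (metis One_nat_def Suc_le_D not0_implies_Suc)
    \<comment> \<open>\<open>harm (n + 1) - ln (n + 1)\<close> decreases in \<open>n\<close> and
      equals 1 at \<open>n = 0\<close>.\<close>
    have "harm (Suc m) - ln (real (Suc m)) \<le> harm (Suc 0) - ln (real (Suc 0))"
      using decseqD[OF decseq_harm_diff_ln, of 0 m] by simp
    then have "harm (K - 1) \<le> ln (real (K - 1)) + (1::real)" using m by (simp add: harm_def)
    also have "\<dots> \<le> ln (real K) + 1" using False assms by simp
    finally show ?thesis .
  qed (simp add: harm_def)
  ultimately show ?thesis by simp
qed

text \<open>Writing \<open>n = m\<^sup>2 \<Prod>D\<close> with \<open>D\<close> a set of primes bounds \<open>harm z\<close> by \<open>(\<Sum>m. 1 / m\<^sup>2) (\<Prod>p \<le> z. 1 + 1 / p)\<close>.\<close>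

lemma sum_inverse_primes_ge:
  assumes "z \<ge> 2"
  shows "ln (ln (real z)) - ln 2 \<le> (\<Sum>p | prime p \<and> p \<le> z. 1 / real p)"
proof -
  let ?P = "{p :: nat. prime p \<and> p \<le> z}"
  define g :: "nat \<Rightarrow> nat \<times> nat set" where "g n = (square_part n, prime_factors (squarefree_part n))" for n
  have sf: "squarefree_part n = \<Prod>(prime_factors (squarefree_part n))" for n :: nat
  proof -
    have "multiplicity p (squarefree_part n) = 1" if "p \<in> prime_factors (squarefree_part n)" for p
    proof (rule antisym)
      show "multiplicity p (squarefree_part n) \<le> 1"
        using that squarefree_factorial_semiring''[of "squarefree_part n"] by auto
      show "1 \<le> multiplicity p (squarefree_part n)"
        using that by (auto simp: prime_factors_multiplicity)
    qed
    then have "(\<Prod>p\<in>prime_factors (squarefree_part n). p ^ multiplicity p (squarefree_part n))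
        = \<Prod>(prime_factors (squarefree_part n))"
      by (intro prod.cong) auto
    then show ?thesis using prime_factorization_nat[of "squarefree_part n"] squarefree_part_nonzero[of n] by simp
  qed
  have dec: "n = \<Prod>(snd (g n)) * fst (g n) ^ 2" for n
    using squarefree_decompose[of n] sf[of n] by (simp add: g_def)
  then have inj: "inj_on g {1..z}" by (metis inj_onI)
  have sub: "g ` {1..z} \<subseteq> {1..z} \<times> Pow ?P"
  proof (rule image_subsetI)
    fix n assume n: "n \<in> {1..z}"
    have dvd: "square_part n ^ 2 dvd n" "squarefree_part n dvd n"
      using squarefree_decompose[of n] by (metis dvd_triv_left dvd_triv_right)+
    have "square_part n dvd n"
      using dvd(1) by (rule dvd_trans[rotated]) simp
    then have "square_part n \<in> {1..z}"
      using n dvd_imp_le[of "square_part n" n] dvd_pos_nat[of n "square_part n"] by auto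
    moreover have "p \<le> z" if "p \<in> prime_factors (squarefree_part n)" for p
    proof -
      have "p dvd n" using that dvd(2) by (meson dvd_trans in_prime_factors_imp_dvd)
      then have "p \<le> n" using n by (intro dvd_imp_le) auto
      then show ?thesis using n by simp
    qed
    ultimately show "g n \<in> {1..z} \<times> Pow ?P" by (auto simp: g_def)
  qed
  let ?f = "\<lambda>(m :: nat, D :: nat set). 1 / real m ^ 2 * (\<Prod>p\<in>D. 1 / real p)"
  have "harm z = (\<Sum>n=1..z. 1 / real n)" by (simp add: harm_def field_simps)
  also have "\<dots> = (\<Sum>n=1..z. ?f (g n))"
  proof (intro sum.cong refl)
    fix n
    have "1 / real n = 1 / (real (\<Prod>(snd (g n))) * real (fst (g n)) ^ 2)" by (subst dec[of n]) simp
    also have "\<dots> = ?f (g n)" by (simp add: case_prod_beta prod_dividef)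
    finally show "1 / real n = ?f (g n)" .
  qed
  also have "\<dots> = (\<Sum>x\<in>g ` {1..z}. ?f x)" using inj by (simp add: sum.reindex)
  also have "\<dots> \<le> (\<Sum>x\<in>{1..z} \<times> Pow ?P. ?f x)"
    using sub by (intro sum_mono2) (auto intro!: divide_nonneg_nonneg prod_nonneg)
  also have "\<dots> = (\<Sum>m=1..z. 1 / real m ^ 2) * (\<Sum>D\<in>Pow ?P. \<Prod>p\<in>D. 1 / real p)"
    unfolding sum_product by (simp add: sum.cartesian_product)
  also have "(\<Sum>D\<in>Pow ?P. \<Prod>p\<in>D. 1 / real p) = (\<Prod>p\<in>?P. 1 / real p + 1)"
    by (subst prod_add) auto
  also have "(\<Sum>m=1..z. 1 / real m ^ 2) * \<dots> \<le> 2 * exp (\<Sum>p\<in>?P. 1 / real p)"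
  proof (intro mult_mono)
    \<comment> \<open>The sharper bound \<open>2 - 1 / n\<close> makes the induction
      telescope.\<close>
    have "(\<Sum>m=1..n. 1 / real m ^ 2) \<le> 2 - 1 / real n" if "n \<ge> 1" for n
      using that
    proof (induction n rule: nat_induct_at_least)
      case (Suc n)
      have "1 / real (Suc n) ^ 2 \<le> 1 / real n - 1 / real (Suc n)"
      proof -
        have "1 / real (Suc n) ^ 2 \<le> 1 / (real n * real (Suc n))"
          using Suc.hyps by (intro divide_left_mono) (auto simp: power2_eq_square)
        also have "\<dots> = 1 / real n - 1 / real (Suc n)"
          using Suc.hyps by (simp add: field_simps)
        finally show ?thesis .
      qed
      then show ?case using Suc.IH by simp
    qed simp
    from this[of z] have "(\<Sum>m=1..z. 1 / real m ^ 2) \<le> 2 - 1 / real z" using assms by simp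
    moreover have "1 / real z \<ge> 0" by simp
    ultimately show "(\<Sum>m=1..z. 1 / real m ^ 2) \<le> 2" by linarith
    show "(\<Prod>p\<in>?P. 1 / real p + 1) \<le> exp (\<Sum>p\<in>?P. 1 / real p)"
      unfolding exp_sum[OF primes_upto_finite]
    proof (intro prod_mono conjI)
      fix p
      show "1 / real p + 1 \<le> exp (1 / real p)"
        using exp_ge_add_one_self[of "1 / real p"] by linarith
    qed simp
  qed (auto intro!: prod_nonneg)
  finally have h: "(harm z :: real) \<le> 2 * exp (\<Sum>p\<in>?P. 1 / real p)" .
  have "ln (real z) \<le> harm z" 
  proof -
    have "ln (real z) \<le> ln (real z + 1)" using assms by simp
    then show ?thesis using ln_le_harm[of z] by linarith
  qed
  then have "ln (real z) \<le> 2 * exp (\<Sum>p\<in>?P. 1 / real p)" using h by linarith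
  then have "ln (ln (real z)) \<le> ln (2 * exp (\<Sum>p\<in>?P. 1 / real p))"
    using assms by (subst ln_le_cancel_iff) auto
  then show ?thesis by (simp add: ln_mult)
qed

section \<open>Brun's pure sieve\<close>

lemma card_cong_class_bound:
  fixes m x c :: nat
  assumes m: "m > 0"
  shows "\<bar>real (card {n \<in> {1..x}. [n = c] (mod m)}) - real x / real m\<bar> \<le> 1"
proof -
  \<comment> \<open>The representative is taken in \<open>{1..m}\<close> because the count starts at
    1; the members of the class are then \<open>b + k * m\<close> with \<open>k\<close> from 0
    on.\<close>
  define b where "b = (if c mod m = 0 then m else c mod m)"
  have b: "1 \<le> b" "b \<le> m" "b mod m = c mod m"
    using m by (auto simp: b_def intro: less_imp_le)
  \<comment> \<open>The number of \<open>k\<close> with \<open>b + k * m\<close> at most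
    \<open>x\<close>; adding \<open>m\<close> first keeps the natural subtraction from being
    truncated.\<close>
  define q where "q = (x + m - b) div m"
  have le_iff: "b + k * m \<le> x \<longleftrightarrow> k < q" for k
  proof -
    have "b + k * m \<le> x \<longleftrightarrow> Suc k * m \<le> x + m - b" using b by auto
    also have "\<dots> \<longleftrightarrow> Suc k \<le> q" unfolding q_def using m by (simp add: less_eq_div_iff_mult_less_eq)
    finally show ?thesis by (simp add: Suc_le_eq)
  qed
  have "{n \<in> {1..x}. [n = c] (mod m)} = (\<lambda>k. b + k * m) ` {..<q}"
  proof (intro equalityI subsetI)
    fix n assume n: "n \<in> {n \<in> {1..x}. [n = c] (mod m)}"
    have eq: "n mod m = b mod m" using n b by (simp add: cong_def)
    have "b \<le> n"
    proof (cases "c mod m = 0")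
      case True
      then have "m dvd n" using eq b by auto
      then show ?thesis using n True by (auto simp: b_def intro: dvd_imp_le)
    next
      case False
      then have "b = n mod m" using eq b by (simp add: b_def)
      then show ?thesis by simp
    qed
    then obtain k where "n = b + k * m"
      using eq by (metis mod_eq_dvd_iff_nat dvdE le_add_diff_inverse mult.commute)
    then show "n \<in> (\<lambda>k. b + k * m) ` {..<q}" using n le_iff by auto
  next
    fix n assume "n \<in> (\<lambda>k. b + k * m) ` {..<q}"
    then obtain k where k: "n = b + k * m" "k < q" by auto
    then have "n \<le> x" using le_iff by auto
    moreover have "[n = c] (mod m)" using b k by (simp add: cong_def)
    ultimately show "n \<in> {n \<in> {1..x}. [n = c] (mod m)}" using b k by auto
  qed
  moreover have "inj_on (\<lambda>k. b + k * m) {..<q}" using m by (auto simp: inj_on_def)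
  ultimately have card: "card {n \<in> {1..x}. [n = c] (mod m)} = q" by (simp add: card_image)
  have "q * m \<le> x + m - b" "x + m - b < Suc q * m"
    unfolding q_def using m dividend_less_div_times[of m "x + m - b"] by (auto simp: algebra_simps)
  then have "q * m \<le> x + m" "x \<le> Suc q * m" using b by linarith+
  then have "real (q * m) \<le> real (x + m)" "real x \<le> real (Suc q * m)"
    by (simp_all only: of_nat_le_iff)
  then have "real q * m \<le> real x + m" "real x \<le> real q * m + m" by (simp_all add: algebra_simps)
  then show ?thesis using m unfolding card abs_le_iff by (simp add: field_simps)
qed

text \<open>Chinese remainder theorem, in the form that lets sifting conditions be absorbed into the
  modulus one prime at a time.\<close>

lemma cong_inter_prime_class:
  fixes m p c u :: nat
  assumes "coprime m p"
  obtains c' where "\<And>n. [n = c] (mod m) \<and> [n = u] (mod p) \<longleftrightarrow> [n = c'] (mod (m * p))"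
proof -
  obtain c' where c': "[c' = c] (mod m)" "[c' = u] (mod p)"
    using binary_chinese_remainder_nat[OF assms] by blast
  have "[n = c] (mod m) \<and> [n = u] (mod p) \<longleftrightarrow> [n = c'] (mod (m * p))" for n
  proof
    assume n: "[n = c] (mod m) \<and> [n = u] (mod p)"
    then show "[n = c'] (mod (m * p))"
      using c' assms by (intro coprime_cong_mult_nat) (auto intro: cong_trans cong_sym)
  next
    assume "[n = c'] (mod (m * p))"
    then have "[n = c'] (mod m)" "[n = c'] (mod p)"
      by (auto intro: cong_dvd_modulus_nat)
    then show "[n = c] (mod m) \<and> [n = u] (mod p)"
      using c' by (auto intro: cong_trans)
  qed
  then show thesis using that by blast
qed

text \<open>As \<open>p\<close> does not divide \<open>d\<close>, the condition at \<open>p\<close>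
  selects two distinct classes, 0 and \<open>- d\<close>. All conditions together give
  \<open>2 ^ card D\<close> classes modulo \<open>m * \<Prod>D\<close>, each counted with error at
  most 1. The class of \<open>c\<close> modulo \<open>m\<close> is carried along for the induction
  on \<open>D\<close>.\<close>

lemma card_sifted_class_bound:
  fixes d x m c :: nat
  assumes "finite D" "\<And>p. p \<in> D \<Longrightarrow> prime p" "\<And>p. p \<in> D \<Longrightarrow> \<not> p dvd d"
    and "m > 0" "\<And>p. p \<in> D \<Longrightarrow> coprime m p"
  shows "\<bar>real (card {n \<in> {1..x}. [n = c] (mod m) \<and> (\<forall>p\<in>D. p dvd n \<or> p dvd n + d)})
            - real x / real m * (\<Prod>p\<in>D. 2 / real p)\<bar> \<le> 2 ^ card D"
  using assms
proof (induction D arbitrary: m c rule: finite_induct)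
  case empty
  then show ?case using card_cong_class_bound[of m x c] by simp
next
  case (insert p D)
  have p: "prime p" "\<not> p dvd d" "coprime m p" "p > 0"
    using insert.prems prime_gt_0_nat by auto
  \<comment> \<open>A natural number congruent to \<open>- d\<close> modulo
    \<open>p\<close>.\<close>
  define u where "u = d * (p - 1)"
  have "u + d = d * p" using p by (cases p) (auto simp: u_def)
  then have u: "[u + d = 0] (mod p)" by (simp add: cong_0_iff)
  have dvd1: "p dvd n \<longleftrightarrow> [n = 0] (mod p)" for n by (simp add: cong_0_iff)
  have dvd2: "p dvd n + d \<longleftrightarrow> [n = u] (mod p)" for n
  proof -
    have "p dvd n + d \<longleftrightarrow> [n + d = u + d] (mod p)"
      using u by (metis cong_0_iff cong_sym cong_trans)
    then show ?thesis by (simp add: cong_add_rcancel_nat)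
  qed
  obtain c1 where c1: "\<And>n. [n = c] (mod m) \<and> [n = 0] (mod p) \<longleftrightarrow> [n = c1] (mod (m * p))"
    using cong_inter_prime_class[OF p(3)] by blast
  obtain c2 where c2: "\<And>n. [n = c] (mod m) \<and> [n = u] (mod p) \<longleftrightarrow> [n = c2] (mod (m * p))"
    using cong_inter_prime_class[OF p(3)] by blast
  define A where "A c' = {n \<in> {1..x}. [n = c'] (mod (m * p)) \<and> (\<forall>p\<in>D. p dvd n \<or> p dvd n + d)}" for c'
  have split: "{n \<in> {1..x}. [n = c] (mod m) \<and> (\<forall>p\<in>insert p D. p dvd n \<or> p dvd n + d)} = A c1 \<union> A c2"
    unfolding A_def c1[symmetric] c2[symmetric] dvd1[symmetric] dvd2[symmetric] by auto
  \<comment> \<open>A common element would make \<open>p\<close> divide both \<open>n\<close> and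
    \<open>n + d\<close>, hence \<open>d\<close>.\<close>
  have "A c1 \<inter> A c2 = {}"
    unfolding A_def c1[symmetric] c2[symmetric] dvd1[symmetric] dvd2[symmetric]
    using p by (auto simp: dvd_add_right_iff)
  then have card: "card (A c1 \<union> A c2) = card (A c1) + card (A c2)"
    by (intro card_Un_disjoint) (auto simp: A_def)
  have *: "\<bar>real (card (A c')) - real x / real (m * p) * (\<Prod>p\<in>D. 2 / real p)\<bar> \<le> 2 ^ card D" for c'
    unfolding A_def
  proof (rule insert.IH)
    fix q assume q: "q \<in> D"
    then have "coprime p q" using insert.hyps insert.prems p by (metis insertCI primes_coprime)
    then show "coprime (m * p) q" using insert.prems q by (simp add: coprime_mult_left_iff)
  qed (use insert.prems p in auto)
  have "real x / real m * (\<Prod>p\<in>insert p D. 2 / real p)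
      = 2 * (real x / real (m * p) * (\<Prod>p\<in>D. 2 / real p))"
    using insert.hyps by simp
  moreover have "(2 :: real) ^ card (insert p D) = 2 * 2 ^ card D"
    using insert.hyps by simp
  moreover have "\<bar>a + b - 2 * M\<bar> \<le> 2 * E" if "\<bar>a - M\<bar> \<le> E" "\<bar>b - M\<bar> \<le> E" for a b M E :: real
    using that by linarith
  ultimately show ?case
    unfolding split card using *[of c1] *[of c2] by (simp only: of_nat_add)
qed

section \<open>Truncated inclusion-exclusion\<close>

text \<open>Grouped by size, the subsets give a partial alternating sum of binomial coefficients,
  equal to \<open>(-1) ^ r\<close> times \<open>card B - 1\<close> over \<open>r\<close>. For even
  \<open>r\<close> and nonempty \<open>B\<close> this is a natural number; for empty
  \<open>B\<close> only the empty subset occurs.\<close>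

lemma bonferroni_even:
  assumes "finite B" "even r"
  shows "(if B = {} then 1 else 0) \<le> (\<Sum>D | D \<subseteq> B \<and> card D \<le> r. (-1 :: real) ^ card D)"
proof -
  have fin: "finite {D. D \<subseteq> B \<and> card D \<le> r}"
    using assms(1) by (rule_tac finite_subset[of _ "Pow B"]) auto
  have "(\<Sum>D | D \<subseteq> B \<and> card D \<le> r. (-1 :: real) ^ card D)
      = (\<Sum>j\<le>r. \<Sum>D\<in>{D. D \<in> {D. D \<subseteq> B \<and> card D \<le> r} \<and> card D = j}. (-1) ^ card D)"
    by (rule sum.group[symmetric]) (use fin in auto)
  also have "\<dots> = (\<Sum>j\<le>r. real (card B choose j) * (-1) ^ j)"
  proof (rule sum.cong)
    fix j assume "j \<in> {..r}"
    then have "{D. D \<in> {D. D \<subseteq> B \<and> card D \<le> r} \<and> card D = j} = {D. D \<subseteq> B \<and> card D = j}" by auto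
    then show "(\<Sum>D\<in>{D. D \<in> {D. D \<subseteq> B \<and> card D \<le> r} \<and> card D = j}. (-1 :: real) ^ card D)
       = real (card B choose j) * (-1) ^ j"
      using n_subsets[OF assms(1), of j] by simp
  qed simp
  also have "\<dots> = (\<Sum>j\<le>r. (real (card B) gchoose j) * (-1) ^ j)"
    by (simp add: binomial_gbinomial)
  also have "\<dots> = (-1) ^ r * (real (card B) - 1 gchoose r)"
    by (rule gbinomial_sum_lower_neg)
  finally have eq: "(\<Sum>D | D \<subseteq> B \<and> card D \<le> r. (-1 :: real) ^ card D) = real (card B) - 1 gchoose r"
    using assms by simp
  show ?thesis
  proof (cases "B = {}")
    case True
    then have "{D. D \<subseteq> B \<and> card D \<le> r} = {{}}" by auto
    then show ?thesis using True by simp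
  next
    case False
    then have "real (card B) - 1 = real (card B - 1)"
      using assms(1) by (simp add: of_nat_diff Suc_leI card_gt_0_iff)
    then have "real (card B) - 1 gchoose r = real (card B - 1 choose r)"
      by (simp only: binomial_gbinomial)
    then show ?thesis using False eq by simp
  qed
qed

text \<open>The sum over subsets is the product of the factors \<open>f p + 1\<close>; they are
  nonnegative, so the inequalities \<open>f p + 1 \<le> exp (f p)\<close> can be multiplied. The
  sieve takes \<open>f p\<close> to be \<open>- 2 / p\<close> for the main term,
  \<open>2 * exp 1 / p\<close> for the tail and \<open>2 / Z\<close> for the remainder.\<close>

lemma sum_Pow_prod_le_exp:
  fixes f :: "'a \<Rightarrow> real"
  assumes "finite Q" "\<And>p. p \<in> Q \<Longrightarrow> - 1 \<le> f p"
  shows "(\<Sum>D\<in>Pow Q. \<Prod>p\<in>D. f p) \<le> exp (\<Sum>p\<in>Q. f p)"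
proof -
  have "(\<Sum>D\<in>Pow Q. \<Prod>p\<in>D. f p) = (\<Prod>p\<in>Q. f p + 1)"
    using assms by (subst prod_add) auto
  also have "\<dots> \<le> (\<Prod>p\<in>Q. exp (f p))"
  proof (intro prod_mono conjI)
    fix p assume "p \<in> Q"
    then show "0 \<le> f p + 1" using assms(2)[of p] by simp
    show "f p + 1 \<le> exp (f p)" using exp_ge_add_one_self[of "f p"] by linarith
  qed
  finally show ?thesis using assms(1) by (simp add: exp_sum)
qed

text \<open>Inclusion-exclusion cut off at subsets of even size \<open>r\<close> overestimates the
  count. Per unit of \<open>x\<close>, the completed main sum is at most
  \<open>exp (- 2 * S)\<close> and the omitted subsets cost \<open>exp (2 * exp 1 * S - r)\<close>;
  the errors \<open>2 ^ card D\<close> add up to at most \<open>exp 2 * Z ^ r\<close>.\<close>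

theorem brun_pure_sieve_two_classes:
  fixes d x r :: nat and Z :: real
  assumes Q: "finite Q" "\<And>p. p \<in> Q \<Longrightarrow> prime p" "\<And>p. p \<in> Q \<Longrightarrow> \<not> p dvd d"
    and r: "even r" and Z: "1 \<le> Z" "real (card Q) \<le> Z"
  defines "S \<equiv> \<Sum>p\<in>Q. 1 / real p"
  shows "real (card {n \<in> {1..x}. \<forall>p\<in>Q. \<not> p dvd n \<and> \<not> p dvd n + d})
           \<le> real x * (exp (- 2 * S) + exp (2 * exp 1 * S - real r)) + exp 2 * Z ^ r"
proof -
  define bad where "bad n = {p \<in> Q. p dvd n \<or> p dvd n + d}" for n
  define DD where "DD = {D. D \<subseteq> Q \<and> card D \<le> r}"
  define cnt where "cnt D = card {n \<in> {1..x}. \<forall>p\<in>D. p dvd n \<or> p dvd n + d}" for D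
  have finDD: "finite DD" using Q(1) unfolding DD_def
    by (rule_tac finite_subset[of _ "Pow Q"]) auto
  have finD: "finite D" if "D \<subseteq> Q" for D using that Q(1) finite_subset by blast
  have ppos: "real p \<ge> 2" if "p \<in> Q" for p
    using Q(2)[OF that] prime_ge_2_nat[of p] by simp
  have "real (card {n \<in> {1..x}. \<forall>p\<in>Q. \<not> p dvd n \<and> \<not> p dvd n + d})
      = (\<Sum>n=1..x. if bad n = {} then 1 else 0)"
  proof -
    have "{n \<in> {1..x}. \<forall>p\<in>Q. \<not> p dvd n \<and> \<not> p dvd n + d} = {n \<in> {1..x}. bad n = {}}"
      by (auto simp: bad_def)
    then show ?thesis by (simp flip: sum.inter_filter)
  qed
  also have "\<dots> \<le> (\<Sum>n=1..x. \<Sum>D | D \<subseteq> bad n \<and> card D \<le> r. (-1) ^ card D)"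
    using Q(1) r by (intro sum_mono bonferroni_even) (auto simp: bad_def)
  also have "\<dots> = (\<Sum>n=1..x. \<Sum>D\<in>DD. if D \<subseteq> bad n then (-1) ^ card D else 0)"
  proof (rule sum.cong)
    fix n
    have "{D. D \<subseteq> bad n \<and> card D \<le> r} = {D \<in> DD. D \<subseteq> bad n}" by (auto simp: DD_def bad_def)
    then show "(\<Sum>D | D \<subseteq> bad n \<and> card D \<le> r. (-1 :: real) ^ card D)
        = (\<Sum>D\<in>DD. if D \<subseteq> bad n then (-1) ^ card D else 0)"
      using finDD by (simp add: sum.inter_filter)
  qed simp
  also have "\<dots> = (\<Sum>D\<in>DD. \<Sum>n=1..x. if D \<subseteq> bad n then (-1) ^ card D else 0)"
    by (rule sum.swap)
  also have "\<dots> = (\<Sum>D\<in>DD. (-1) ^ card D * real (cnt D))"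
  proof (rule sum.cong)
    fix D assume "D \<in> DD"
    then have "{n \<in> {1..x}. D \<subseteq> bad n} = {n \<in> {1..x}. \<forall>p\<in>D. p dvd n \<or> p dvd n + d}"
      by (auto simp: DD_def bad_def)
    then show "(\<Sum>n=1..x. if D \<subseteq> bad n then (-1 :: real) ^ card D else 0) = (-1) ^ card D * real (cnt D)"
      by (simp add: cnt_def mult.commute flip: sum.inter_filter)
  qed simp
  also have "\<dots> \<le> (\<Sum>D\<in>DD. real x * (\<Prod>p\<in>D. - 2 / real p) + 2 ^ card D)"
  proof (rule sum_mono)
    fix D assume "D \<in> DD"
    then have D: "D \<subseteq> Q" by (simp add: DD_def)
    have "\<bar>real (cnt D) - real x * (\<Prod>p\<in>D. 2 / real p)\<bar> \<le> 2 ^ card D"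
      using card_sifted_class_bound[of D d 1 x 0] D Q finD[OF D] by (auto simp: cnt_def)
    moreover have "(\<Prod>p\<in>D. - 2 / real p) = (-1) ^ card D * (\<Prod>p\<in>D. 2 / real p)"
      by (simp flip: prod_constant prod.distrib)
    ultimately show "(-1) ^ card D * real (cnt D) \<le> real x * (\<Prod>p\<in>D. - 2 / real p) + 2 ^ card D"
      by (cases "even (card D)") (auto simp: abs_le_iff)
  qed
  also have "\<dots> = real x * (\<Sum>D\<in>DD. \<Prod>p\<in>D. - 2 / real p) + (\<Sum>D\<in>DD. 2 ^ card D)"
    by (simp add: sum.distrib sum_distrib_left)
  also have "\<dots> \<le> real x * (exp (- 2 * S) + exp (2 * exp 1 * S - real r)) + exp 2 * Z ^ r"
  proof (intro add_mono mult_left_mono)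
    \<comment> \<open>The truncated sum is completed to all subsets of \<open>Q\<close>, where it
      factors; the difference is the tail.\<close>
    have "(\<Sum>D\<in>DD. \<Prod>p\<in>D. - 2 / real p)
        = (\<Sum>D\<in>Pow Q. \<Prod>p\<in>D. - 2 / real p) - (\<Sum>D\<in>Pow Q - DD. \<Prod>p\<in>D. - 2 / real p)"
      using Q(1) by (subst sum_diff) (auto simp: DD_def)
    moreover have "(\<Sum>D\<in>Pow Q. \<Prod>p\<in>D. - 2 / real p) \<le> exp (- 2 * S)"
    proof -
      have "- 1 \<le> - 2 / real p" if "p \<in> Q" for p using ppos[OF that] by simp
      then have "(\<Sum>D\<in>Pow Q. \<Prod>p\<in>D. - 2 / real p) \<le> exp (\<Sum>p\<in>Q. - 2 / real p)"
        by (rule sum_Pow_prod_le_exp[OF Q(1)])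
      also have "(\<Sum>p\<in>Q. - 2 / real p) = - 2 * S"
        unfolding S_def sum_distrib_left by (rule sum.cong) auto
      finally show ?thesis .
    qed
    \<comment> \<open>Rankin's trick: \<open>1 \<le> exp (card D - r)\<close> for the omitted \<open>D\<close>.\<close>
    moreover have "- (\<Sum>D\<in>Pow Q - DD. \<Prod>p\<in>D. - 2 / real p) \<le> exp (2 * exp 1 * S - real r)"
    proof -
      have "- (\<Sum>D\<in>Pow Q - DD. \<Prod>p\<in>D. - 2 / real p)
          \<le> (\<Sum>D\<in>Pow Q - DD. exp (- real r) * (\<Prod>p\<in>D. 2 * exp 1 / real p))"
        unfolding sum_negf[symmetric]
      proof (rule sum_mono)
        fix D assume D: "D \<in> Pow Q - DD"
        have "- (\<Prod>p\<in>D. - 2 / real p) \<le> \<bar>\<Prod>p\<in>D. - 2 / real p\<bar>" by simp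
        also have "\<dots> = (\<Prod>p\<in>D. 2 / real p)" by (simp add: abs_prod)
        also have "\<dots> \<le> exp (real (card D) - real r) * (\<Prod>p\<in>D. 2 / real p)"
        proof -
          have "1 * (\<Prod>p\<in>D. 2 / real p) \<le> exp (real (card D) - real r) * (\<Prod>p\<in>D. 2 / real p)"
            using D by (intro mult_right_mono) (auto simp: DD_def intro!: prod_nonneg)
          then show ?thesis by simp
        qed
        also have "\<dots> = exp (- real r) * (exp 1 ^ card D * (\<Prod>p\<in>D. 2 / real p))"
          by (simp add: exp_diff exp_minus field_simps flip: exp_of_nat_mult)
        also have "exp 1 ^ card D * (\<Prod>p\<in>D. 2 / real p) = (\<Prod>p\<in>D. 2 * exp 1 / real p)"
          by (simp add: mult.commute flip: prod_constant prod.distrib)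
        finally show "- (\<Prod>p\<in>D. - 2 / real p) \<le> exp (- real r) * (\<Prod>p\<in>D. 2 * exp 1 / real p)" .
      qed
      also have "\<dots> \<le> (\<Sum>D\<in>Pow Q. exp (- real r) * (\<Prod>p\<in>D. 2 * exp 1 / real p))"
        using Q(1) by (intro sum_mono2) (auto intro!: mult_nonneg_nonneg prod_nonneg)
      also have "\<dots> \<le> exp (- real r) * exp (2 * exp 1 * S)"
        unfolding sum_distrib_left[symmetric]
      proof (rule mult_left_mono)
        have "- 1 \<le> 2 * exp 1 / real p" for p :: nat
          by (rule order_trans[of _ 0]) auto
        then show "(\<Sum>D\<in>Pow Q. \<Prod>p\<in>D. 2 * exp 1 / real p) \<le> exp (2 * exp 1 * S)"
          using sum_Pow_prod_le_exp[OF Q(1), of "\<lambda>p. 2 * exp 1 / real p"]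
          by (auto simp: S_def sum_distrib_left)
      qed simp
      also have "\<dots> = exp (2 * exp 1 * S - real r)" by (simp flip: exp_add)
      finally show ?thesis .
    qed
    ultimately show "(\<Sum>D\<in>DD. \<Prod>p\<in>D. - 2 / real p) \<le> exp (- 2 * S) + exp (2 * exp 1 * S - real r)"
      by linarith
    \<comment> \<open>The same device for the remainder: \<open>card D \<le> r\<close> and
      \<open>Z \<ge> 1\<close> give the weight \<open>Z ^ (r - card D) \<ge> 1\<close>, and the
      weighted sum over all subsets is at most \<open>Z ^ r * exp (2 * card Q / Z)\<close>.\<close>
    have "(\<Sum>D\<in>DD. 2 ^ card D) \<le> (\<Sum>D\<in>DD. Z ^ r * (\<Prod>p\<in>D. 2 / Z))"
    proof (rule sum_mono)
      fix D assume "D \<in> DD"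
      then have "Z ^ card D \<le> Z ^ r" using Z by (intro power_increasing) (auto simp: DD_def)
      then have "2 ^ card D * Z ^ card D \<le> 2 ^ card D * Z ^ r" by simp
      then show "2 ^ card D \<le> Z ^ r * (\<Prod>p\<in>D. 2 / Z)"
        using Z by (simp add: field_simps)
    qed
    also have "\<dots> \<le> (\<Sum>D\<in>Pow Q. Z ^ r * (\<Prod>p\<in>D. 2 / Z))"
      using Q(1) Z by (intro sum_mono2) (auto simp: DD_def intro!: mult_nonneg_nonneg prod_nonneg)
    also have "\<dots> \<le> Z ^ r * exp 2"
      unfolding sum_distrib_left[symmetric]
    proof (rule mult_left_mono)
      have "(\<Sum>D\<in>Pow Q. \<Prod>p\<in>D. 2 / Z) \<le> exp (\<Sum>p\<in>Q. 2 / Z)"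
        using Z by (intro sum_Pow_prod_le_exp[OF Q(1)]) (auto intro: order_trans[of _ 0])
      also have "\<dots> \<le> exp 2" using Z by (simp add: field_simps)
      finally show "(\<Sum>D\<in>Pow Q. \<Prod>p\<in>D. 2 / Z) \<le> exp 2" .
    qed (use Z in simp)
    finally show "(\<Sum>D\<in>DD. 2 ^ card D) \<le> exp 2 * Z ^ r" by (simp add: mult.commute)
  qed simp
  finally show ?thesis .
qed

section \<open>Pairs of primes with a given difference\<close>

text \<open>The product of the distinct prime divisors is at most \<open>d\<close>, and each of them
  is at least 2.\<close>

lemma card_prime_divisors_le:
  fixes d :: nat
  assumes "d > 0"
  shows "real (card {p. prime p \<and> p dvd d}) * ln 2 \<le> ln (real d)"
proof -
  let ?A = "{p. prime p \<and> p dvd d}"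
  have fin: "finite ?A"
    by (rule finite_subset[OF _ finite_divisors_nat[OF assms]]) auto
  have "2 ^ card ?A \<le> \<Prod>?A"
    using prod_mono[of ?A "\<lambda>_. 2" "\<lambda>p. p"] by (simp add: prime_ge_2_nat)
  also have "\<dots> \<le> d"
  proof (rule dvd_imp_le[OF _ assms])
    show "\<Prod>?A dvd d" by (rule prod_primes_dvd[OF fin]) auto
  qed
  finally have "real (2 ^ card ?A) \<le> real d" by (simp only: of_nat_le_iff)
  then have "ln (2 ^ card ?A) \<le> ln (real d)" using assms by (subst ln_le_cancel_iff) auto
  then show ?thesis by (simp add: ln_realpow)
qed

text \<open>The divisors up to \<open>2 ^ J\<close> are bounded by all primes up to
  \<open>2 ^ J\<close>; the larger ones number at most \<open>ln d / ln 2\<close> and contribute at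
  most 2. With \<open>2 ^ J\<close> about \<open>ln d\<close>, dropping the primes that divide
  \<open>d\<close> from the sieve thus costs little.\<close>

lemma sum_inverse_prime_divisors_le:
  fixes d J :: nat
  assumes d: "d > 0" and J: "J \<ge> 1" "ln (real d) \<le> 2 ^ J"
  shows "(\<Sum>p | prime p \<and> p dvd d. 1 / real p) \<le> 2 * ln (real J) + 9 / 2"
proof -
  let ?A = "{p. prime p \<and> p dvd d}"
  have fin: "finite ?A"
    by (rule finite_subset[OF _ finite_divisors_nat[OF d]]) auto
  define B where "B = {p \<in> ?A. p > 2 ^ J}"
  have finB: "finite B" unfolding B_def using fin by (rule rev_finite_subset) auto
  have "(\<Sum>p\<in>?A. 1 / real p) \<le> (\<Sum>p\<in>{p. prime p \<and> p \<le> 2 ^ J} \<union> B. 1 / real p)"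
    using fin finB by (intro sum_mono2) (auto simp: B_def)
  also have "\<dots> = (\<Sum>p | prime p \<and> p \<le> 2 ^ J. 1 / real p) + (\<Sum>p\<in>B. 1 / real p)"
    using finB by (intro sum.union_disjoint) (auto simp: B_def)
  also have "(\<Sum>p\<in>B. 1 / real p) \<le> (\<Sum>p\<in>B. 1 / 2 ^ J)"
  proof (rule sum_mono)
    fix p assume "p \<in> B"
    then have "real (2 ^ J) \<le> real p" by (simp only: of_nat_le_iff) (simp add: B_def)
    then have "2 ^ J \<le> real p" by simp
    then show "1 / real p \<le> 1 / 2 ^ J"
      by (intro divide_left_mono mult_pos_pos) (auto intro: less_le_trans[of 0 "2 ^ J"])
  qed
  also have "\<dots> = card B / 2 ^ J" by simp
  also have "\<dots> \<le> card ?A / 2 ^ J"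
    using fin by (intro divide_right_mono) (auto simp: B_def intro: card_mono)
  also have "\<dots> \<le> 2"
  proof -
    have "real (card ?A) * (2 / 3) \<le> real (card ?A) * ln 2"
      using ln2_ge_two_thirds by (intro mult_left_mono) auto
    also have "\<dots> \<le> 2 ^ J" using card_prime_divisors_le[OF d] J(2) by linarith
    finally have "real (card ?A) \<le> 3 / 2 * 2 ^ J" by linarith
    also have "\<dots> \<le> 2 * 2 ^ J" by simp
    finally show ?thesis by (simp add: field_simps)
  qed
  finally show ?thesis using sum_inverse_primes_pow2_le[OF J(1)] by linarith
qed

text \<open>The sieving primes are those up to \<open>2 ^ K\<close> that do not divide
  \<open>d\<close>: if \<open>n > 2 ^ K\<close> and both \<open>n\<close> and \<open>n + d\<close>
  are prime, none of them divides either number. Smaller \<open>n\<close> are counted trivially.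
  Leaving out the divisors of \<open>d\<close> accounts for the factor \<open>J ^ 4\<close>.\<close>

lemma card_prime_pairs_le:
  fixes x d K J r :: nat
  assumes d: "d > 0" and K: "K \<ge> 1" and J: "J \<ge> 1" "ln (real d) \<le> 2 ^ J" and r: "even r"
  shows "real (card {n \<in> {1..x}. prime n \<and> prime (n + d)})
    \<le> 2 ^ K + real x * (exp 12 * real J ^ 4 / real K ^ 2 + exp (12 * ln (real K) + 15 - real r))
       + exp 2 * (2 ^ K) ^ r"
proof -
  define Q where "Q = {p :: nat. prime p \<and> p \<le> 2 ^ K \<and> \<not> p dvd d}"
  define S where "S = (\<Sum>p\<in>Q. 1 / real p)"
  have finQ: "finite Q" unfolding Q_def by (rule finite_subset[of _ "{..2 ^ K}"]) auto
  have fin: "finite {p. prime p \<and> p dvd d}"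
    by (rule finite_subset[OF _ finite_divisors_nat[OF d]]) auto
  have cardQ: "real (card Q) \<le> 2 ^ K"
  proof -
    have "card Q \<le> card {1..2 ^ K :: nat}"
      by (intro card_mono) (auto simp: Q_def prime_ge_Suc_0_nat)
    then have "real (card Q) \<le> real (2 ^ K)" by (simp only: of_nat_le_iff) simp
    then show ?thesis by simp
  qed
  have S_le: "S \<le> 2 * ln (real K) + 5 / 2"
  proof -
    have "S \<le> (\<Sum>p | prime p \<and> p \<le> 2 ^ K. 1 / real p)"
      unfolding S_def by (intro sum_mono2) (auto simp: Q_def)
    then show ?thesis using sum_inverse_primes_pow2_le[OF K] by linarith
  qed
  \<comment> \<open>The 6 collects \<open>9 / 2\<close> from the prime divisors of \<open>d\<close>,
    \<open>1 / 2\<close> from \<open>ln (ln 2)\<close> and 1 from \<open>ln 2\<close>.\<close>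
  have S_ge: "ln (real K) - 2 * ln (real J) - 6 \<le> S"
  proof -
    have "(2 :: nat) ^ 1 \<le> 2 ^ K" using K by (intro power_increasing) auto
    then have "ln (ln (real (2 ^ K))) - ln 2 \<le> (\<Sum>p | prime p \<and> p \<le> 2 ^ K. 1 / real p)"
      using sum_inverse_primes_ge[of "2 ^ K"] by simp
    moreover have "(\<Sum>p | prime p \<and> p \<le> 2 ^ K. 1 / real p) \<le> (\<Sum>p\<in>Q \<union> {p. prime p \<and> p dvd d}. 1 / real p)"
      using finQ fin by (intro sum_mono2) (auto simp: Q_def)
    moreover have "\<dots> = S + (\<Sum>p | prime p \<and> p dvd d. 1 / real p)"
      unfolding S_def using finQ fin by (intro sum.union_disjoint) (auto simp: Q_def)
    moreover have "ln (ln (real (2 ^ K))) = ln (real K) + ln (ln 2)"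
      using K by (simp add: ln_realpow ln_mult)
    moreover have "ln (ln 2) \<ge> - (1 / 2 :: real)"
    proof -
      have "ln (1 / ln 2) \<le> 1 / ln 2 - (1 :: real)" by (rule ln_le_minus_one) auto
      moreover have "1 / ln 2 \<le> (3 / 2 :: real)" using ln2_ge_two_thirds by (simp add: field_simps)
      ultimately show ?thesis by (simp add: ln_div)
    qed
    moreover have "ln 2 \<le> (1 :: real)" using ln_le_minus_one[of "2 :: real"] by simp
    ultimately show ?thesis using sum_inverse_prime_divisors_le[OF d J] by linarith
  qed
  have S_nonneg: "S \<ge> 0" unfolding S_def by (intro sum_nonneg) auto
  have "exp (- 2 * S) \<le> exp (12 + 4 * ln (real J) - 2 * ln (real K))"
    using S_ge by simp
  also have "\<dots> = exp 12 * real J ^ 4 / real K ^ 2"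
  proof -
    have "exp (4 * ln (real J)) = real J ^ 4" "exp (2 * ln (real K)) = real K ^ 2"
      using J K exp_of_nat_mult[of 4 "ln (real J)"] exp_of_nat_mult[of 2 "ln (real K)"] by simp_all
    then show ?thesis by (simp add: exp_add exp_diff)
  qed
  finally have main: "exp (- 2 * S) \<le> exp 12 * real J ^ 4 / real K ^ 2" .
  \<comment> \<open>With \<open>exp 1 \<le> 3\<close> the exponent is at most
    \<open>6 * S - r\<close>, and 6 times the upper bound for \<open>S\<close> is
    \<open>12 * ln K + 15\<close>.\<close>
  have tail: "exp (2 * exp 1 * S - real r) \<le> exp (12 * ln (real K) + 15 - real r)"
  proof -
    have "2 * exp 1 * S \<le> 2 * 3 * S" using exp_le S_nonneg by (intro mult_right_mono) auto
    also have "\<dots> \<le> 12 * ln (real K) + 15" using S_le by simp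
    finally show ?thesis by simp
  qed
  let ?B = "{n \<in> {1..x}. \<forall>p\<in>Q. \<not> p dvd n \<and> \<not> p dvd n + d}"
  have "{n \<in> {1..x}. prime n \<and> prime (n + d)} \<subseteq> {1..2 ^ K} \<union> ?B"
  proof
    fix n assume n: "n \<in> {n \<in> {1..x}. prime n \<and> prime (n + d)}"
    have "\<not> p dvd n \<and> \<not> p dvd n + d" if "n > 2 ^ K" "p \<in> Q" for p
      using that n primes_dvd_imp_eq[of p n] primes_dvd_imp_eq[of p "n + d"] by (auto simp: Q_def)
    then show "n \<in> {1..2 ^ K} \<union> ?B" using n by (cases "n \<le> 2 ^ K") auto
  qed
  then have "card {n \<in> {1..x}. prime n \<and> prime (n + d)} \<le> card ({1..2 ^ K} \<union> ?B)"
    by (intro card_mono) auto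
  also have "\<dots> \<le> 2 ^ K + card ?B"
    using card_Un_le[of "{1..2 ^ K}" ?B] by simp
  finally have "real (card {n \<in> {1..x}. prime n \<and> prime (n + d)}) \<le> real (2 ^ K + card ?B)"
    by (simp only: of_nat_le_iff)
  then have "real (card {n \<in> {1..x}. prime n \<and> prime (n + d)}) \<le> 2 ^ K + real (card ?B)"
    by simp
  also have "real (card ?B) \<le> real x * (exp (- 2 * S) + exp (2 * exp 1 * S - real r)) + exp 2 * (2 ^ K) ^ r"
    unfolding S_def using finQ cardQ r
    by (intro brun_pure_sieve_two_classes) (auto simp: Q_def)
  also have "\<dots> \<le> real x * (exp 12 * real J ^ 4 / real K ^ 2 + exp (12 * ln (real K) + 15 - real r))
       + exp 2 * (2 ^ K) ^ r"
    using main tail by (intro add_mono mult_left_mono) auto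
  finally show ?thesis by simp
qed

text \<open>Up to rounding, the sieve bound with \<open>K = ln x powr (2/3)\<close>,
  \<open>J = 2 * ln (ln x)\<close> and \<open>r = 2 * ln x powr (1/4)\<close>. The main term wins
  because \<open>2 * (2/3) > 1\<close>, the remainder is smaller than any power of \<open>x\<close>
  because \<open>2/3 + 1/4 < 1\<close>, and the tail is small because \<open>r\<close> outgrows
  \<open>12 * ln K\<close>.\<close>

lemma prime_pairs_bound_asymptotic:
  "((\<lambda>x :: real. (2 powr (ln x powr (2/3)) + x * (exp 12 * (2 * ln (ln x) + 1) ^ 4 / (ln x powr (2/3) - 1) ^ 2
       + exp (12 * ln (ln x powr (2/3)) + 15 - (2 * ln x powr (1/4) - 2)))
       + exp 2 * 2 powr (2 * ln x powr (2/3) * ln x powr (1/4))) / (x / ln x)) \<longlongrightarrow> 0) at_top"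
  by real_asymp

text \<open>Uniformity in \<open>d\<close> holds because \<open>d\<close> enters the sieve bound
  only through \<open>ln d \<le> 2 ^ J\<close>, which follows from
  \<open>ln x \<le> 2 ^ J\<close>.\<close>

theorem card_prime_pairs_small:
  assumes "\<epsilon> > 0"
  shows "\<forall>\<^sub>F x :: nat in sequentially. \<forall>d\<in>{1..x}.
           real (card {n \<in> {1..x}. prime n \<and> prime (n + d)}) \<le> \<epsilon> * (real x / ln (real x))"
proof -
  define g :: "real \<Rightarrow> real" where "g x = 2 powr (ln x powr (2/3)) + x * (exp 12 * (2 * ln (ln x) + 1) ^ 4 / (ln x powr (2/3) - 1) ^ 2
       + exp (12 * ln (ln x powr (2/3)) + 15 - (2 * ln x powr (1/4) - 2)))
       + exp 2 * 2 powr (2 * ln x powr (2/3) * ln x powr (1/4))" for x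
  have "((\<lambda>x. g x / (x / ln x)) \<longlongrightarrow> 0) at_top"
    unfolding g_def by (rule prime_pairs_bound_asymptotic)
  then have "\<forall>\<^sub>F x in at_top. g x / (x / ln x) < \<epsilon>"
    using assms by (rule order_tendstoD)
  \<comment> \<open>This gives \<open>k > 2\<close> and \<open>ln L > 1\<close> below, so that the
    rounded \<open>K\<close> and \<open>J\<close> are at least 1.\<close>
  moreover have "\<forall>\<^sub>F x :: real in at_top. ln x > 8" by real_asymp
  moreover have "\<forall>\<^sub>F x :: real in at_top. x > 1" by real_asymp
  ultimately have "\<forall>\<^sub>F x in at_top. x > 1 \<and> ln x > 8 \<and> g x / (x / ln x) < \<epsilon>"
    by eventually_elim auto
  then have "\<forall>\<^sub>F x :: nat in sequentially. real x > 1 \<and> ln (real x) > 8 \<and> g (real x) / (real x / ln (real x)) < \<epsilon>"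
    by (rule eventually_compose_filterlim[OF _ filterlim_real_sequentially])
  then show ?thesis
  proof eventually_elim
    case (elim x)
    define L where "L = ln (real x)"
    have x: "real x > 1" and L: "L > 8" and g: "g (real x) / (real x / L) < \<epsilon>"
      using elim by (auto simp: L_def)
    define k where "k = L powr (2/3)"
    \<comment> \<open>The parameters are rounded to integers; in \<open>g\<close> each occurrence is
      replaced by the real bound that increases the estimate. The outer factor 2 makes
      \<open>r\<close> even.\<close>
    define K where "K = nat \<lfloor>k\<rfloor>"
    define J where "J = nat \<lceil>2 * ln L\<rceil>"
    define r where "r = 2 * nat \<lfloor>L powr (1/4)\<rfloor>"
    have "k > 2"
    proof -
      have "(8 :: real) powr (2/3) = (2 powr 3) powr (2/3)" by simp
      also have "\<dots> = 4" unfolding powr_powr by simp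
      finally have "(8 :: real) powr (2/3) = 4" .
      moreover have "8 powr (2/3) \<le> L powr (2/3)" using L by (intro powr_mono2) auto
      ultimately show ?thesis by (simp add: k_def)
    qed
    have K: "real K \<le> k" "k - 1 \<le> real K" "K \<ge> 1" using \<open>k > 2\<close> unfolding K_def by linarith+
    have lnL: "ln L > 1"
    proof -
      have "exp 1 < L" using exp_le L by linarith
      then show ?thesis using L by (subst (asm) ln_less_cancel_iff[symmetric]) auto
    qed
    have J: "2 * ln L \<le> real J" "real J \<le> 2 * ln L + 1" "J \<ge> 1" using lnL unfolding J_def by linarith+
    have r: "real r \<le> 2 * L powr (1/4)" "2 * L powr (1/4) - 2 \<le> real r" "even r"
    proof -
      have "L powr (1/4) \<ge> 0" by simp
      then show "real r \<le> 2 * L powr (1/4)" "2 * L powr (1/4) - 2 \<le> real r"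
        unfolding r_def by linarith+
    qed (simp add: r_def)
    \<comment> \<open>The factor 2 in \<open>J\<close> compensates for the base, since
      \<open>2 * ln 2 \<ge> 1\<close>.\<close>
    have LJ: "L \<le> 2 ^ J"
    proof -
      have "L = exp (ln L)" using L by simp
      also have "\<dots> \<le> exp (ln 2 * (2 * ln L))"
        using ln2_ge_two_thirds lnL by simp
      also have "\<dots> \<le> exp (ln 2 * real J)" using J by simp
      also have "\<dots> = 2 ^ J" by (simp add: powr_def mult.commute flip: powr_realpow)
      finally show ?thesis .
    qed
    show ?case
    proof
      fix d assume d: "d \<in> {1..x}"
      have "ln (real d) \<le> 2 ^ J"
      proof -
        have "ln (real d) \<le> L" unfolding L_def using d by (subst ln_le_cancel_iff) auto
        then show ?thesis using LJ by linarith
      qed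
      then have "real (card {n \<in> {1..x}. prime n \<and> prime (n + d)})
        \<le> 2 ^ K + real x * (exp 12 * real J ^ 4 / real K ^ 2 + exp (12 * ln (real K) + 15 - real r))
           + exp 2 * (2 ^ K) ^ r"
        using d K J r by (intro card_prime_pairs_le) auto
      also have "\<dots> \<le> g (real x)"
        unfolding g_def L_def[symmetric] k_def[symmetric]
      proof (intro add_mono mult_left_mono)
        show "2 ^ K \<le> 2 powr k" using K by (simp flip: powr_realpow)
        show "exp 12 * real J ^ 4 / real K ^ 2 \<le> exp 12 * (2 * ln L + 1) ^ 4 / (k - 1) ^ 2"
          using K J \<open>k > 2\<close> by (intro frac_le mult_left_mono power_mono) auto
        show "exp (12 * ln (real K) + 15 - real r) \<le> exp (12 * ln k + 15 - (2 * L powr (1/4) - 2))"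
        proof -
          have "ln (real K) \<le> ln k" using K \<open>k > 2\<close> by (subst ln_le_cancel_iff) auto
          then show ?thesis using r by simp
        qed
        have "(2 ^ K) ^ r = 2 powr (real K * real r)"
          by (simp add: powr_realpow power_mult flip: of_nat_mult)
        also have "\<dots> \<le> 2 powr (2 * k * L powr (1/4))"
        proof (intro powr_mono)
          have "real K * real r \<le> k * (2 * L powr (1/4))"
            using K r \<open>k > 2\<close> by (intro mult_mono) auto
          then show "real K * real r \<le> 2 * k * L powr (1/4)" by simp
        qed simp
        finally show "(2 ^ K) ^ r \<le> 2 powr (2 * k * L powr (1/4))" .
      qed auto
      also have "g (real x) \<le> \<epsilon> * (real x / L)"
        using g x L by (simp add: field_simps)
      finally show "real (card {n \<in> {1..x}. prime n \<and> prime (n + d)}) \<le> \<epsilon> * (real x / ln (real x))"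
        by (simp add: L_def)
    qed
  qed
qed

section \<open>Coincidences among differences\<close>

definition ordered_pairs :: "nat \<Rightarrow> (nat \<times> nat) set" where
  "ordered_pairs N = {(i, j). i \<in> {1..N} \<and> j \<in> {1..N} \<and> i \<noteq> j}"

definition elem_diff :: "nat set \<Rightarrow> nat \<times> nat \<Rightarrow> int" where
  "elem_diff A u = int (nth_elem A (fst u)) - int (nth_elem A (snd u))"

text \<open>The additive energy of the first \<open>N\<close> elements without the vanishing
  differences.\<close>

definition diff_energy :: "nat set \<Rightarrow> nat \<Rightarrow> nat" where
  "diff_energy A N =
     card {(u, v). u \<in> ordered_pairs N \<and> v \<in> ordered_pairs N \<and> elem_diff A u = elem_diff A v}"

lemma finite_ordered_pairs [simp]: "finite (ordered_pairs N)"
  by (rule finite_subset[of _ "{1..N} \<times> {1..N}"]) (auto simp: ordered_pairs_def)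

lemma card_ordered_pairs: "card (ordered_pairs N) = N ^ 2 - N"
proof -
  have "ordered_pairs N = {1..N} \<times> {1..N} - (\<lambda>i. (i, i)) ` {1..N}"
    by (auto simp: ordered_pairs_def)
  moreover have "card ((\<lambda>i. (i, i)) ` {1..N}) = N"
    by (subst card_image) (auto simp: inj_on_def)
  ultimately show ?thesis
    by (simp add: card_Diff_subset image_subset_iff power2_eq_square)
qed

lemma diff_energy_eq_sum:
  "diff_energy A N = (\<Sum>v\<in>ordered_pairs N. card {u \<in> ordered_pairs N. elem_diff A u = elem_diff A v})"
proof -
  have "{(u, v). u \<in> ordered_pairs N \<and> v \<in> ordered_pairs N \<and> elem_diff A u = elem_diff A v}
     = prod.swap ` (SIGMA v:ordered_pairs N. {u \<in> ordered_pairs N. elem_diff A u = elem_diff A v})"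
    by force
  then have "diff_energy A N
     = card (SIGMA v:ordered_pairs N. {u \<in> ordered_pairs N. elem_diff A u = elem_diff A v})"
    unfolding diff_energy_def by (simp add: card_image)
  then show ?thesis by simp
qed

lemma nth_elem_strict_mono:
  assumes "infinite A" "1 \<le> i" "i < j"
  shows "nth_elem A i < nth_elem A j"
  unfolding nth_elem_def using assms by (intro enumerate_mono) auto

lemma nth_elem_in: "infinite A \<Longrightarrow> nth_elem A i \<in> A"
  unfolding nth_elem_def by (rule enumerate_in_set)

lemma nth_elem_inj:
  assumes "infinite A" "1 \<le> i" "1 \<le> j" "nth_elem A i = nth_elem A j"
  shows "i = j"
  using nth_elem_strict_mono[OF assms(1)] assms by (metis less_irrefl linorder_neqE_nat)

lemma nth_elem_ge: "infinite A \<Longrightarrow> i - 1 \<le> nth_elem A i"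
  unfolding nth_elem_def by (rule le_enumerate)

text \<open>For the primes this says that \<open>N\<close> is the number of primes up to the
  \<open>N\<close>-th one, so Chebyshev's bound becomes a lower bound for \<open>N\<close>.\<close>

lemma card_le_nth_elem:
  assumes "infinite A" "N \<ge> 1"
  shows "card {a \<in> A. a \<le> nth_elem A N} = N"
proof -
  have "{a \<in> A. a \<le> nth_elem A N} = nth_elem A ` {1..N}"
  proof (intro equalityI subsetI)
    fix a assume a: "a \<in> {a \<in> A. a \<le> nth_elem A N}"
    then obtain n where n: "a = enumerate A n" using enumerate_Ex[OF assms(1), of a] by auto
    then have eq: "a = nth_elem A (Suc n)" by (simp add: nth_elem_def)
    moreover have "Suc n \<le> N"
    proof (rule ccontr)
      assume "\<not> Suc n \<le> N"
      then have "nth_elem A N < nth_elem A (Suc n)" by (intro nth_elem_strict_mono assms) auto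
      then show False using a eq by simp
    qed
    ultimately show "a \<in> nth_elem A ` {1..N}" by auto
  next
    fix a assume "a \<in> nth_elem A ` {1..N}"
    then obtain i where i: "1 \<le> i" "i \<le> N" "a = nth_elem A i" by auto
    then show "a \<in> {a \<in> A. a \<le> nth_elem A N}"
      using nth_elem_strict_mono[OF assms(1), of i N] nth_elem_in[OF assms(1)]
      by (cases "i = N") auto
  qed
  moreover have "inj_on (nth_elem A) {1..N}"
    using nth_elem_inj[OF assms(1)] by (auto intro: inj_onI)
  ultimately show ?thesis by (simp add: card_image)
qed

text \<open>A pair with a given nonzero difference is determined by its smaller element
  \<open>n\<close>, and the larger one is \<open>n + d\<close>.\<close>

lemma card_elem_diff_le:
  assumes A: "infinite A" "0 \<notin> A" and v: "v \<in> ordered_pairs N"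
  defines "d \<equiv> nat \<bar>elem_diff A v\<bar>" and "x \<equiv> nth_elem A N"
  shows "d \<in> {1..x}"
    and "card {u \<in> ordered_pairs N. elem_diff A u = elem_diff A v}
           \<le> card {n \<in> {1..x}. n \<in> A \<and> n + d \<in> A}"
proof -
  have range: "nth_elem A i \<in> A" "nth_elem A i \<in> {1..x}" if "i \<in> {1..N}" for i
  proof -
    show "nth_elem A i \<in> A" by (rule nth_elem_in[OF A(1)])
    then have "nth_elem A i \<noteq> 0" using A(2) by metis
    moreover have "nth_elem A i \<le> x"
      unfolding x_def using that nth_elem_strict_mono[OF A(1), of i N] by (cases "i = N") auto
    ultimately show "nth_elem A i \<in> {1..x}" by auto
  qed
  show d: "d \<in> {1..x}"
  proof -
    obtain i j where ij: "v = (i, j)" "i \<in> {1..N}" "j \<in> {1..N}" "i \<noteq> j"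
      using v by (auto simp: ordered_pairs_def)
    have "nth_elem A i \<noteq> nth_elem A j" using nth_elem_inj[OF A(1), of i j] ij by auto
    then show ?thesis
      using range(2)[OF ij(2)] range(2)[OF ij(3)] ij(1) by (auto simp: d_def elem_diff_def)
  qed
  let ?U = "{u \<in> ordered_pairs N. elem_diff A u = elem_diff A v}"
  \<comment> \<open>The smaller of the two elements; the sign of the common difference decides which
    coordinate that is.\<close>
  define h where "h u = (if elem_diff A v > 0 then nth_elem A (snd u) else nth_elem A (fst u))" for u
  have inj: "inj_on h ?U"
  proof (rule inj_onI)
    fix u u' assume u: "u \<in> ?U" "u' \<in> ?U" and eq: "h u = h u'"
    have "nth_elem A (fst u) = nth_elem A (fst u')" "nth_elem A (snd u) = nth_elem A (snd u')"
      using u eq by (auto simp: h_def elem_diff_def split: if_splits)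
    then show "u = u'"
      using u nth_elem_inj[OF A(1), of "fst u" "fst u'"] nth_elem_inj[OF A(1), of "snd u" "snd u'"]
      by (auto simp: ordered_pairs_def)
  qed
  have "h ` ?U \<subseteq> {n \<in> {1..x}. n \<in> A \<and> n + d \<in> A}"
  proof (rule image_subsetI)
    fix u assume u: "u \<in> ?U"
    have mem: "fst u \<in> {1..N}" "snd u \<in> {1..N}" using u by (auto simp: ordered_pairs_def)
    have e: "elem_diff A v = int (nth_elem A (fst u)) - int (nth_elem A (snd u))"
      using u by (simp add: elem_diff_def)
    have "nth_elem A (snd u) + d = nth_elem A (fst u)" if "elem_diff A v > 0"
      using that unfolding d_def e by arith
    moreover have "nth_elem A (fst u) + d = nth_elem A (snd u)" if "\<not> elem_diff A v > 0"
      using that unfolding d_def e by arith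
    ultimately show "h u \<in> {n \<in> {1..x}. n \<in> A \<and> n + d \<in> A}"
      using range[OF mem(1)] range[OF mem(2)] by (auto simp: h_def)
  qed
  then have "card (h ` ?U) \<le> card {n \<in> {1..x}. n \<in> A \<and> n + d \<in> A}" by (intro card_mono) auto
  then show "card ?U \<le> card {n \<in> {1..x}. n \<in> A \<and> n + d \<in> A}" using inj by (simp add: card_image)
qed

text \<open>Each of at most \<open>N ^ 2\<close> pairs shares its difference with at most as many
  pairs as there are pairs of primes at that distance, and this is a small multiple of
  \<open>x / ln x\<close>, hence of \<open>N\<close>.\<close>

theorem diff_energy_primes:
  "(\<lambda>N. real (diff_energy {p. prime p} N) / real N ^ 3) \<longlonglongrightarrow> 0"
proof (rule LIMSEQ_I)
  fix \<epsilon> :: real assume "\<epsilon> > 0"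
  define P where "P = {p :: nat. prime p}"
  have inf: "infinite P" "0 \<notin> P" using primes_infinite by (auto simp: P_def)
  \<comment> \<open>Chebyshev's constant 8 turns \<open>\<epsilon> / 16\<close> into
    \<open>\<epsilon> / 2\<close>, which leaves room for a strict inequality.\<close>
  have "\<forall>\<^sub>F x in sequentially. (\<forall>d\<in>{1..x}.
           real (card {n \<in> {1..x}. prime n \<and> prime (n + d)}) \<le> \<epsilon> / 16 * (real x / ln (real x)))
         \<and> real x / (8 * ln (real x)) \<le> real (card {p :: nat. prime p \<and> p \<le> x})"
    using \<open>\<epsilon> > 0\<close> by (intro eventually_conj card_primes_ge card_prime_pairs_small) auto
  then obtain x0 where x0: "\<And>x. x \<ge> x0 \<Longrightarrow> (\<forall>d\<in>{1..x}.
           real (card {n \<in> {1..x}. prime n \<and> prime (n + d)}) \<le> \<epsilon> / 16 * (real x / ln (real x)))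
         \<and> real x / (8 * ln (real x)) \<le> real (card {p :: nat. prime p \<and> p \<le> x})"
    unfolding eventually_sequentially by blast
  have "real (diff_energy P N) / real N ^ 3 < \<epsilon>" if N: "N \<ge> x0 + 1" for N
  proof -
    define x where "x = nth_elem P N"
    \<comment> \<open>\<open>nth_elem_ge\<close> gives only \<open>N - 1 \<le> x\<close>, hence the
      threshold \<open>x0 + 1\<close> for \<open>N\<close>.\<close>
    have "x \<ge> x0" using nth_elem_ge[OF inf(1), of N] N by (simp add: x_def)
    note x = x0[OF this]
    have cN: "card {p. prime p \<and> p \<le> x} = N"
      using card_le_nth_elem[OF inf(1), of N] N by (simp add: P_def x_def)
    have N0: "real N > 0" using N by simp
    have "card {u \<in> ordered_pairs N. elem_diff P u = elem_diff P v} \<le> \<epsilon> / 2 * real N"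
      if v: "v \<in> ordered_pairs N" for v
    proof -
      define d where "d = nat \<bar>elem_diff P v\<bar>"
      have "real (card {u \<in> ordered_pairs N. elem_diff P u = elem_diff P v})
          \<le> real (card {n \<in> {1..x}. prime n \<and> prime (n + d)})"
        using card_elem_diff_le(2)[OF inf v] by (simp add: P_def x_def d_def)
      also have "\<dots> \<le> \<epsilon> / 16 * (real x / ln (real x))"
        using x card_elem_diff_le(1)[OF inf v] by (simp add: x_def d_def)
      also have "\<dots> = \<epsilon> / 2 * (real x / (8 * ln (real x)))" by simp
      also have "\<dots> \<le> \<epsilon> / 2 * real N"
        using x cN \<open>\<epsilon> > 0\<close> by (intro mult_left_mono) auto
      finally show ?thesis .
    qed
    then have "real (diff_energy P N) \<le> real (card (ordered_pairs N)) * (\<epsilon> / 2 * real N)"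
      unfolding diff_energy_eq_sum of_nat_sum by (rule sum_bounded_above)
    also have "\<dots> \<le> real N ^ 2 * (\<epsilon> / 2 * real N)"
    proof (rule mult_right_mono)
      have "real (card (ordered_pairs N)) \<le> real (N ^ 2)"
        unfolding card_ordered_pairs of_nat_le_iff by simp
      then show "real (card (ordered_pairs N)) \<le> real N ^ 2" by simp
    qed (use \<open>\<epsilon> > 0\<close> in simp)
    also have "\<dots> = \<epsilon> / 2 * real N ^ 3" by (simp add: power2_eq_square power3_eq_cube)
    also have "\<dots> < \<epsilon> * real N ^ 3" using \<open>\<epsilon> > 0\<close> N0 by simp
    finally show ?thesis using N0 by (simp add: field_simps)
  qed
  then show "\<exists>no. \<forall>n\<ge>no. norm (real (diff_energy {p. prime p} n) / real n ^ 3 - 0) < \<epsilon>"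
    unfolding P_def by (intro exI[of _ "x0 + 1"]) auto
qed

section \<open>Pairwise independence on the torus\<close>

text \<open>The integers are closed, so the infimum is attained. Invariance under integer shifts and
  negation then amounts to changing the witness \<open>k\<close>.\<close>

lemma circle_norm_le_iff: "circle_norm x \<le> \<delta> \<longleftrightarrow> (\<exists>k :: int. \<bar>x - of_int k\<bar> \<le> \<delta>)"
proof
  assume "circle_norm x \<le> \<delta>"
  moreover obtain y where "y \<in> \<int>" "infdist x \<int> = dist x y"
    using infdist_attains_inf[of "\<int> :: real set" x] closed_Ints by (auto simp: Ints_def)
  ultimately show "\<exists>k :: int. \<bar>x - of_int k\<bar> \<le> \<delta>"
    by (auto simp: circle_norm_def dist_real_def elim!: Ints_cases)
next
  assume "\<exists>k :: int. \<bar>x - of_int k\<bar> \<le> \<delta>"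
  then obtain k :: int where "\<bar>x - of_int k\<bar> \<le> \<delta>" by blast
  moreover have "infdist x \<int> \<le> dist x (of_int k)" by (rule infdist_le) simp
  ultimately show "circle_norm x \<le> \<delta>" by (simp add: circle_norm_def dist_real_def)
qed

text \<open>The closed ball about 0 in the circle, lifted to a 1-periodic subset of the
  line.\<close>

definition circle_ball :: "real \<Rightarrow> real set" where
  "circle_ball \<delta> = {x. circle_norm x \<le> \<delta>}"

lemma circle_ball_closed: "closed (circle_ball \<delta>)"
  unfolding circle_ball_def circle_norm_def by (intro closed_Collect_le continuous_intros)

lemma circle_ball_measurable [measurable]: "circle_ball \<delta> \<in> sets borel"
  using circle_ball_closed by (rule borel_closed)

lemma circle_ball_add_1: "x + 1 \<in> circle_ball \<delta> \<longleftrightarrow> x \<in> circle_ball \<delta>"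
proof -
  have "(\<exists>k :: int. \<bar>x + 1 - of_int k\<bar> \<le> \<delta>) \<longleftrightarrow> (\<exists>k :: int. \<bar>x - of_int k\<bar> \<le> \<delta>)"
  proof
    assume "\<exists>k :: int. \<bar>x + 1 - of_int k\<bar> \<le> \<delta>"
    then obtain k :: int where "\<bar>x + 1 - of_int k\<bar> \<le> \<delta>" by blast
    then show "\<exists>k :: int. \<bar>x - of_int k\<bar> \<le> \<delta>" by (intro exI[of _ "k - 1"]) (simp add: algebra_simps)
  next
    assume "\<exists>k :: int. \<bar>x - of_int k\<bar> \<le> \<delta>"
    then obtain k :: int where "\<bar>x - of_int k\<bar> \<le> \<delta>" by blast
    then show "\<exists>k :: int. \<bar>x + 1 - of_int k\<bar> \<le> \<delta>" by (intro exI[of _ "k + 1"]) (simp add: algebra_simps)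
  qed
  then show ?thesis by (simp add: circle_ball_def circle_norm_le_iff)
qed

lemma circle_ball_uminus: "- x \<in> circle_ball \<delta> \<longleftrightarrow> x \<in> circle_ball \<delta>"
proof -
  have *: "- x \<in> circle_ball \<delta>" if x: "x \<in> circle_ball \<delta>" for x
  proof -
    obtain k :: int where "\<bar>x - of_int k\<bar> \<le> \<delta>" using x by (auto simp: circle_ball_def circle_norm_le_iff)
    then have "\<bar>- x - of_int (- k)\<bar> \<le> \<delta>" by simp
    then show ?thesis unfolding circle_ball_def mem_Collect_eq circle_norm_le_iff by blast
  qed
  show ?thesis using *[of x] *[of "- x"] by auto
qed

section \<open>Integrals of 1-periodic functions\<close>

lemma nn_integral_shift:
  fixes f :: "real \<Rightarrow> ennreal"
  assumes [measurable]: "f \<in> borel_measurable borel"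
  shows "(\<integral>\<^sup>+x. f x \<partial>lborel) = (\<integral>\<^sup>+x. f (x + b) \<partial>lborel)"
  using nn_integral_real_affine[of f 1 b] by (simp add: add.commute)

lemma periodic_of_int:
  fixes f :: "real \<Rightarrow> 'a"
  assumes "\<And>x. f (x + 1) = f x"
  shows "f (x + of_int k) = f x"
proof (induction k rule: int_induct[where k = 0])
  case (step1 i)
  then show ?case using assms[of "x + of_int i"] by (simp add: add.assoc)
next
  case (step2 i)
  then show ?case using assms[of "x + of_int i - 1"] by (simp add: algebra_simps)
qed simp

text \<open>An integer translation makes the interval start at \<open>t = frac c\<close>; its part
  beyond 1 is then moved back by 1 onto \<open>{0..<t}\<close>.\<close>

lemma nn_integral_period:
  fixes f :: "real \<Rightarrow> ennreal"
  assumes [measurable]: "f \<in> borel_measurable borel" and per: "\<And>x. f (x + 1) = f x"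
  shows "(\<integral>\<^sup>+x. f x * indicator {c..<c + 1} x \<partial>lborel) = (\<integral>\<^sup>+x. f x * indicator {0..<1} x \<partial>lborel)"
proof -
  define t where "t = frac c"
  have t: "0 \<le> t" "t < 1" "c = t + of_int \<lfloor>c\<rfloor>" unfolding t_def
    by (auto simp: frac_ge_0 frac_lt_1) (simp add: frac_def)
  have "(\<integral>\<^sup>+x. f x * indicator {c..<c + 1} x \<partial>lborel)
      = (\<integral>\<^sup>+x. f (x + of_int \<lfloor>c\<rfloor>) * indicator {c..<c + 1} (x + of_int \<lfloor>c\<rfloor>) \<partial>lborel)"
    by (rule nn_integral_shift) simp
  also have "\<dots> = (\<integral>\<^sup>+x. f x * indicator {t..<t + 1} x \<partial>lborel)"
    using t(3) by (intro nn_integral_cong) (auto simp: periodic_of_int[of f, OF per] split: split_indicator)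
  also have "\<dots> = (\<integral>\<^sup>+x. f x * indicator {t..<1} x + f x * indicator {1..<1 + t} x \<partial>lborel)"
    using t by (intro nn_integral_cong) (auto split: split_indicator)
  also have "\<dots> = (\<integral>\<^sup>+x. f x * indicator {t..<1} x \<partial>lborel) + (\<integral>\<^sup>+x. f x * indicator {1..<1 + t} x \<partial>lborel)"
    by (rule nn_integral_add) simp_all
  also have "(\<integral>\<^sup>+x. f x * indicator {1..<1 + t} x \<partial>lborel) = (\<integral>\<^sup>+x. f (x + 1) * indicator {1..<1 + t} (x + 1) \<partial>lborel)"
    by (rule nn_integral_shift) simp
  also have "\<dots> = (\<integral>\<^sup>+x. f x * indicator {0..<t} x \<partial>lborel)"
    by (intro nn_integral_cong) (auto simp: per split: split_indicator)
  also have "(\<integral>\<^sup>+x. f x * indicator {t..<1} x \<partial>lborel) + \<dots>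
      = (\<integral>\<^sup>+x. f x * indicator {t..<1} x + f x * indicator {0..<t} x \<partial>lborel)"
    by (rule nn_integral_add[symmetric]) simp_all
  also have "\<dots> = (\<integral>\<^sup>+x. f x * indicator {0..<1} x \<partial>lborel)"
    using t by (intro nn_integral_cong) (auto split: split_indicator)
  finally show ?thesis .
qed

lemma nn_integral_periods:
  fixes f :: "real \<Rightarrow> ennreal"
  assumes [measurable]: "f \<in> borel_measurable borel" and per: "\<And>x. f (x + 1) = f x"
  shows "(\<integral>\<^sup>+x. f x * indicator {c..<c + real k} x \<partial>lborel)
           = of_nat k * (\<integral>\<^sup>+x. f x * indicator {0..<1} x \<partial>lborel)"
proof (induction k)
  case (Suc k)
  have "(\<integral>\<^sup>+x. f x * indicator {c..<c + real (Suc k)} x \<partial>lborel)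
     = (\<integral>\<^sup>+x. f x * indicator {c..<c + real k} x + f x * indicator {c + real k..<c + real k + 1} x \<partial>lborel)"
    by (intro nn_integral_cong) (auto split: split_indicator)
  also have "\<dots> = (\<integral>\<^sup>+x. f x * indicator {c..<c + real k} x \<partial>lborel)
     + (\<integral>\<^sup>+x. f x * indicator {c + real k..<c + real k + 1} x \<partial>lborel)"
    by (rule nn_integral_add) simp_all
  finally show ?case
    using Suc nn_integral_period[of f "c + real k"] per by (simp add: distrib_right add.commute)
qed simp

text \<open>The substitution maps \<open>{0..<1}\<close> onto \<open>k\<close> periods starting at
  \<open>c\<close>, and its Jacobian cancels their number: multiplication by \<open>k\<close>
  preserves the measure of the circle.\<close>

lemma nn_integral_period_scale:
  fixes f :: "real \<Rightarrow> ennreal"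
  assumes [measurable]: "f \<in> borel_measurable borel" and per: "\<And>x. f (x + 1) = f x"
    and k: "k > 0"
  shows "(\<integral>\<^sup>+x. f (real k * x + c) * indicator {0..<1} x \<partial>lborel)
           = (\<integral>\<^sup>+x. f x * indicator {0..<1} x \<partial>lborel)"
proof -
  have "of_nat k * (\<integral>\<^sup>+x. f x * indicator {0..<1} x \<partial>lborel)
      = (\<integral>\<^sup>+x. f x * indicator {c..<c + real k} x \<partial>lborel)"
    by (rule nn_integral_periods[symmetric]) (use per in auto)
  also have "\<dots> = ennreal (real k) * (\<integral>\<^sup>+x. f (c + real k * x) * indicator {c..<c + real k} (c + real k * x) \<partial>lborel)"
    using k by (subst nn_integral_real_affine[of _ "real k" c]) auto
  also have "(\<integral>\<^sup>+x. f (c + real k * x) * indicator {c..<c + real k} (c + real k * x) \<partial>lborel)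
      = (\<integral>\<^sup>+x. f (real k * x + c) * indicator {0..<1} x \<partial>lborel)"
    using k by (intro nn_integral_cong) (auto simp: add.commute zero_le_mult_iff split: split_indicator)
  finally show ?thesis using k
    by (simp add: ennreal_of_nat_eq_real_of_nat ennreal_mult_cancel_left)
qed

text \<open>On the period centred at 0 the ball is the single interval
  \<open>{- \<delta>..\<delta>}\<close>, because \<open>\<delta> < 1 / 2\<close> puts all other
  integers out of reach.\<close>

lemma nn_integral_circle_ball:
  assumes "0 \<le> \<delta>" "\<delta> < 1 / 2"
  shows "(\<integral>\<^sup>+x. indicator (circle_ball \<delta>) x * indicator {0..<1} x \<partial>lborel) = ennreal (2 * \<delta>)"
proof -
  have eq: "x \<in> circle_ball \<delta> \<longleftrightarrow> x \<in> {- \<delta>..\<delta>}" if x: "x \<in> {- (1 / 2)..<1 / 2}" for x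
  proof
    assume "x \<in> circle_ball \<delta>"
    then obtain k :: int where k: "\<bar>x - of_int k\<bar> \<le> \<delta>"
      by (auto simp: circle_ball_def circle_norm_le_iff)
    then have "\<bar>of_int k :: real\<bar> < 1" using x assms by (auto simp: abs_le_iff abs_less_iff)
    then have "k = 0" by linarith
    then show "x \<in> {- \<delta>..\<delta>}" using k by (auto simp: abs_le_iff)
  next
    assume "x \<in> {- \<delta>..\<delta>}"
    then show "x \<in> circle_ball \<delta>"
      unfolding circle_ball_def mem_Collect_eq circle_norm_le_iff
      by (intro exI[of _ 0]) (auto simp: abs_le_iff)
  qed
  have "(\<integral>\<^sup>+x. indicator (circle_ball \<delta>) x * indicator {0..<1} x \<partial>lborel)
     = (\<integral>\<^sup>+x. indicator (circle_ball \<delta>) x * indicator {- (1 / 2)..<- (1 / 2) + 1} x \<partial>lborel)"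
    by (rule nn_integral_period[symmetric]) (auto simp: circle_ball_add_1 split: split_indicator)
  also have "\<dots> = (\<integral>\<^sup>+x. indicator {- \<delta>..\<delta>} x \<partial>lborel)"
    using assms eq by (intro nn_integral_cong) (auto split: split_indicator)
  also have "\<dots> = ennreal (2 * \<delta>)" using assms by simp
  finally show ?thesis .
qed

section \<open>Strips on the torus and their measures\<close>

definition unit_box :: "(real \<times> real) set" where
  "unit_box = {0..<1} \<times> {0..<1}"

text \<open>The multiplier is an integer because differences of elements occur with both
  signs.\<close>

definition strip :: "real \<Rightarrow> int \<Rightarrow> (real \<times> real) set" where
  "strip \<delta> m = {z \<in> unit_box. of_int m * fst z - snd z \<in> circle_ball \<delta>}"

lemma unit_box_measurable [measurable]: "unit_box \<in> sets borel"
  unfolding unit_box_def borel_prod[symmetric] by simp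

lemma strip_measurable [measurable]: "strip \<delta> m \<in> sets borel"
proof -
  have "strip \<delta> m = unit_box \<inter> {z. circle_norm (of_int m * fst z - snd z) \<le> \<delta>}"
    by (auto simp: strip_def circle_ball_def)
  moreover have "closed {z :: real \<times> real. circle_norm (of_int m * fst z - snd z) \<le> \<delta>}"
    unfolding circle_norm_def by (intro closed_Collect_le continuous_intros)
  ultimately show ?thesis by (simp add: sets.Int borel_closed)
qed

lemma circle_ball_diff_commute: "x - y \<in> circle_ball \<delta> \<longleftrightarrow> y - x \<in> circle_ball \<delta>"
  using circle_ball_uminus[of "x - y" \<delta>] by simp

lemma nn_integral_period_add:
  fixes f :: "real \<Rightarrow> ennreal"
  assumes [measurable]: "f \<in> borel_measurable borel" and per: "\<And>x. f (x + 1) = f x"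
  shows "(\<integral>\<^sup>+x. f (x + c) * indicator {0..<1} x \<partial>lborel) = (\<integral>\<^sup>+x. f x * indicator {0..<1} x \<partial>lborel)"
  using nn_integral_period_scale[of f 1 c] assms by simp

lemma nn_integral_unit_box:
  assumes [measurable]: "f \<in> borel_measurable (borel \<Otimes>\<^sub>M borel)"
  shows "(\<integral>\<^sup>+z. f z * indicator unit_box z \<partial>lborel)
    = (\<integral>\<^sup>+x. (\<integral>\<^sup>+y. f (x, y) * indicator {0..<1} y \<partial>lborel) * indicator {0..<1} x \<partial>lborel)"
proof -
  have [measurable]: "unit_box \<in> sets (borel \<Otimes>\<^sub>M borel)" unfolding borel_prod by simp
  have "(\<integral>\<^sup>+z. f z * indicator unit_box z \<partial>lborel)
      = (\<integral>\<^sup>+x. (\<integral>\<^sup>+y. f (x, y) * indicator unit_box (x, y) \<partial>lborel) \<partial>lborel)"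
    unfolding lborel_prod[symmetric] by (subst lborel.nn_integral_fst) auto
  also have "\<dots> = (\<integral>\<^sup>+x. (\<integral>\<^sup>+y. f (x, y) * indicator {0..<1} y * indicator {0..<1} x \<partial>lborel) \<partial>lborel)"
    by (intro nn_integral_cong) (auto simp: unit_box_def split: split_indicator)
  also have "\<dots> = (\<integral>\<^sup>+x. (\<integral>\<^sup>+y. f (x, y) * indicator {0..<1} y \<partial>lborel) * indicator {0..<1} x \<partial>lborel)"
    by (intro nn_integral_cong nn_integral_multc) simp
  finally show ?thesis .
qed

text \<open>For a fixed first coordinate the slice is a translate of the ball.\<close>

lemma emeasure_strip:
  assumes "0 \<le> \<delta>" "\<delta> < 1 / 2"
  shows "emeasure lborel (strip \<delta> m) = ennreal (2 * \<delta>)"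
proof -
  have "emeasure lborel (strip \<delta> m)
     = (\<integral>\<^sup>+z. indicator (circle_ball \<delta>) (snd z - of_int m * fst z) * indicator unit_box z \<partial>lborel)"
    unfolding nn_integral_indicator[OF strip_measurable[unfolded sets_lborel[symmetric]], symmetric]
    by (intro nn_integral_cong)
      (auto simp: strip_def circle_ball_diff_commute[of "snd _"] split: split_indicator)
  also have "\<dots> = (\<integral>\<^sup>+x. (\<integral>\<^sup>+y. indicator (circle_ball \<delta>) (y + - of_int m * x) * indicator {0..<1} y \<partial>lborel)
        * indicator {0..<1} x \<partial>lborel)"
    by (subst nn_integral_unit_box) simp_all
  also have "\<dots> = (\<integral>\<^sup>+x. ennreal (2 * \<delta>) * indicator {0..<1::real} x \<partial>lborel)"
  proof (intro nn_integral_cong arg_cong2[where f = "(*)"] refl)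
    fix x :: real
    have "(\<integral>\<^sup>+y. indicator (circle_ball \<delta>) (y + - of_int m * x) * indicator {0..<1} y \<partial>lborel)
        = (\<integral>\<^sup>+y. indicator (circle_ball \<delta>) y * indicator {0..<1} y \<partial>lborel)"
      by (rule nn_integral_period_add) (simp_all add: indicator_def circle_ball_add_1)
    then show "(\<integral>\<^sup>+y. indicator (circle_ball \<delta>) (y + - of_int m * x) * indicator {0..<1} y \<partial>lborel)
        = ennreal (2 * \<delta>)"
      by (simp only: nn_integral_circle_ball[OF assms])
  qed
  finally show ?thesis by (simp add: nn_integral_cmult)
qed

text \<open>A positive multiplier preserves the measure; a negative one is reduced to
  \<open>- k\<close> by the symmetry of the ball.\<close>

lemma nn_integral_circle_ball_scale:
  fixes k :: int
  assumes "0 \<le> \<delta>" "\<delta> < 1 / 2" "k \<noteq> 0"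
  shows "(\<integral>\<^sup>+x. indicator (circle_ball \<delta>) (y + of_int k * x) * indicator {0..<1} x \<partial>lborel)
           = ennreal (2 * \<delta>)"
proof -
  have *: "(\<integral>\<^sup>+x. indicator (circle_ball \<delta>) (real n * x + c) * indicator {0..<1} x \<partial>lborel)
           = ennreal (2 * \<delta>)" if "n > 0" for n c
  proof -
    have "(\<integral>\<^sup>+x. indicator (circle_ball \<delta>) (real n * x + c) * indicator {0..<1} x \<partial>lborel)
        = (\<integral>\<^sup>+x. indicator (circle_ball \<delta>) x * indicator {0..<1} x \<partial>lborel)"
      using that by (intro nn_integral_period_scale) (simp_all add: indicator_def circle_ball_add_1)
    then show ?thesis by (simp only: nn_integral_circle_ball[OF assms(1,2)])
  qed
  show ?thesis
  proof (cases "k > 0")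
    case True
    then show ?thesis using *[of "nat k" y] by (simp add: add.commute)
  next
    case False
    have "y + of_int k * x \<in> circle_ball \<delta> \<longleftrightarrow> real (nat (- k)) * x + - y \<in> circle_ball \<delta>" for x
      using circle_ball_uminus[of "y + of_int k * x" \<delta>] False by (simp add: algebra_simps)
    then have eq: "indicator (circle_ball \<delta>) (y + of_int k * x)
      = (indicator (circle_ball \<delta>) (real (nat (- k)) * x + - y) :: ennreal)" for x
      by (simp only: indicator_def)
    have "nat (- k) > 0" using False assms(3) by simp
    then show ?thesis unfolding eq by (rule *)
  qed
qed

text \<open>
  Translating \<open>\<gamma>\<close> by \<open>m \<alpha>\<close> turns the two conditions into \<open>\<parallel>\<gamma>\<parallel> \<le> \<delta>\<close> and
  \<open>\<parallel>\<gamma> + (m - m') \<alpha>\<parallel> \<le> \<delta>\<close>; the second one is equidistributed in \<open>\<alpha>\<close> for fixed \<open>\<gamma>\<close>.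
\<close>
lemma emeasure_strip_Int:
  assumes "0 \<le> \<delta>" "\<delta> < 1 / 2" "m \<noteq> m'"
  shows "emeasure lborel (strip \<delta> m \<inter> strip \<delta> m') = ennreal ((2 * \<delta>) ^ 2)"
proof -
  let ?U = "indicator (circle_ball \<delta>) :: real \<Rightarrow> ennreal"
  have "emeasure lborel (strip \<delta> m \<inter> strip \<delta> m')
     = (\<integral>\<^sup>+z. (?U (snd z - of_int m * fst z) * ?U (snd z - of_int m' * fst z)) * indicator unit_box z \<partial>lborel)"
    by (subst nn_integral_indicator[symmetric], simp, intro nn_integral_cong)
      (auto simp: strip_def circle_ball_diff_commute[of "snd _"] split: split_indicator)
  also have "\<dots> = (\<integral>\<^sup>+x. (\<integral>\<^sup>+y. (?U (y + - of_int m * x) * ?U (y + - of_int m * x + of_int (m - m') * x))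
        * indicator {0..<1} y \<partial>lborel) * indicator {0..<1} x \<partial>lborel)"
    by (subst nn_integral_unit_box) (simp_all add: algebra_simps)
  also have "\<dots> = (\<integral>\<^sup>+x. (\<integral>\<^sup>+y. (?U y * ?U (y + of_int (m - m') * x)) * indicator {0..<1} y \<partial>lborel)
        * indicator {0..<1} x \<partial>lborel)"
  proof (rule nn_integral_cong, rule arg_cong2[where f = "(*)", OF _ refl])
    fix x :: real
    show "(\<integral>\<^sup>+y. (?U (y + - of_int m * x) * ?U (y + - of_int m * x + of_int (m - m') * x))
        * indicator {0..<1} y \<partial>lborel) = (\<integral>\<^sup>+y. (?U y * ?U (y + of_int (m - m') * x)) * indicator {0..<1} y \<partial>lborel)"
    proof (rule nn_integral_period_add[of "\<lambda>y. ?U y * ?U (y + of_int (m - m') * x)" "- of_int m * x"])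
      fix y :: real
      have "y + 1 + of_int (m - m') * x = (y + of_int (m - m') * x) + 1" by simp
      then show "?U (y + 1) * ?U (y + 1 + of_int (m - m') * x) = ?U y * ?U (y + of_int (m - m') * x)"
        by (simp only: indicator_def circle_ball_add_1)
    qed simp
  qed
  also have "\<dots> = (\<integral>\<^sup>+x. (\<integral>\<^sup>+y. (?U y * indicator {0..<1} y) * (?U (y + of_int (m - m') * x) * indicator {0..<1} x) \<partial>lborel) \<partial>lborel)"
    by (rule nn_integral_cong, subst nn_integral_multc[symmetric]) (simp_all add: ac_simps)
  also have "\<dots> = (\<integral>\<^sup>+y. (\<integral>\<^sup>+x. (?U y * indicator {0..<1} y) * (?U (y + of_int (m - m') * x) * indicator {0..<1} x) \<partial>lborel) \<partial>lborel)"
    by (rule lborel_pair.Fubini') simp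
  also have "\<dots> = (\<integral>\<^sup>+y. (?U y * indicator {0..<1} y) * ennreal (2 * \<delta>) \<partial>lborel)"
  proof (rule nn_integral_cong)
    fix y :: real
    have "(\<integral>\<^sup>+x. (?U y * indicator {0..<1} y) * (?U (y + of_int (m - m') * x) * indicator {0..<1} x) \<partial>lborel)
        = (?U y * indicator {0..<1} y) * (\<integral>\<^sup>+x. ?U (y + of_int (m - m') * x) * indicator {0..<1} x \<partial>lborel)"
      by (rule nn_integral_cmult) simp
    then show "(\<integral>\<^sup>+x. (?U y * indicator {0..<1} y) * (?U (y + of_int (m - m') * x) * indicator {0..<1} x) \<partial>lborel)
        = (?U y * indicator {0..<1} y) * ennreal (2 * \<delta>)"
      using assms by (subst (asm) nn_integral_circle_ball_scale) auto
  qed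
  also have "\<dots> = ennreal (2 * \<delta>) * ennreal (2 * \<delta>)"
    by (subst nn_integral_multc) (simp_all only: nn_integral_circle_ball[OF assms(1,2)], simp)
  also have "\<dots> = ennreal ((2 * \<delta>) ^ 2)"
    using assms by (simp add: power2_eq_square flip: ennreal_mult)
  finally show ?thesis .
qed

section \<open>Second moment and almost everywhere convergence\<close>

lemma strip_subset: "strip \<delta> m \<subseteq> unit_box"
  by (auto simp: strip_def)

lemma emeasure_unit_box: "emeasure lborel unit_box = 1"
proof -
  have "emeasure lborel unit_box
      = (\<integral>\<^sup>+x. (\<integral>\<^sup>+y. indicator {0..<1::real} y \<partial>lborel) * indicator {0..<1::real} x \<partial>lborel)"
    using nn_integral_unit_box[of "\<lambda>_. 1"] by simp
  then show ?thesis by simp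
qed

lemma pair_corr_eq_sum_strips:
  assumes "z \<in> unit_box"
  shows "pair_corr (fst z) (snd z) s N A
    = 1 / real N * (\<Sum>u\<in>ordered_pairs N. indicator (strip (s / real N) (elem_diff A u)) z)"
proof -
  have "{(i, j). i \<in> {1..N} \<and> j \<in> {1..N} \<and> i \<noteq> j \<and>
       circle_norm (real (nth_elem A i) * fst z - real (nth_elem A j) * fst z - snd z) \<le> s / real N}
     = {u \<in> ordered_pairs N. z \<in> strip (s / real N) (elem_diff A u)}"
    using assms by (auto simp: ordered_pairs_def strip_def circle_ball_def elem_diff_def left_diff_distrib)
  moreover have "real (card {u \<in> ordered_pairs N. z \<in> strip (s / real N) (elem_diff A u)})
     = (\<Sum>u\<in>ordered_pairs N. indicator (strip (s / real N) (elem_diff A u)) z)"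
    by (simp add: indicator_def Int_def)
  ultimately show ?thesis by (simp add: pair_corr_def)
qed

text \<open>The square expands into measures of intersections of two strips, which are
  \<open>q\<close> for equal differences and \<open>q ^ 2\<close> for distinct ones. Equal
  differences produce the energy term; what remains is the squared distance of the mean from
  \<open>2 * s\<close>.\<close>

lemma pair_corr_variance:
  assumes s: "s > 0" "s / real N < 1 / 2" and N: "N > 0"
  shows "(\<integral>\<^sup>+z. ennreal ((pair_corr (fst z) (snd z) s N A - 2 * s) ^ 2) * indicator unit_box z \<partial>lborel)
    \<le> ennreal (2 * s * (real (diff_energy A N) / real N ^ 3) + 4 * s ^ 2 / real N ^ 2)"
proof -
  define I where "I = ordered_pairs N"
  define D where "D = elem_diff A"
  define S where "S u = strip (s / real N) (D u)" for u
  define q where "q = 2 * s / real N"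
  define c where "c = 1 / real N"
  define t where "t = 2 * s"
  have fin: "finite I" by (simp add: I_def)
  have q: "0 < q" "q = 2 * (s / real N)" using s N by (simp_all add: q_def)
  have \<delta>: "0 \<le> s / real N" using s by simp
  have SS: "has_bochner_integral lborel (indicator (S u \<inter> S v)) (if D u = D v then q else q ^ 2)" for u v
  proof -
    have em: "emeasure lborel (S u \<inter> S v) = ennreal (if D u = D v then q else q ^ 2)"
      unfolding S_def q(2) using emeasure_strip[OF \<delta> s(2)] emeasure_strip_Int[OF \<delta> s(2)] by auto
    then have "measure lborel (S u \<inter> S v) = (if D u = D v then q else q ^ 2)"
      using q by (simp add: measure_def)
    moreover have "has_bochner_integral lborel (indicator (S u \<inter> S v)) (measure lborel (S u \<inter> S v))"
      using em by (intro has_bochner_integral_real_indicator) (auto simp: S_def less_top[symmetric])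
    ultimately show ?thesis by simp
  qed
  have S: "has_bochner_integral lborel (indicator (S u)) q" for u
    using SS[of u u] by simp
  have box: "has_bochner_integral lborel (indicator unit_box) (1 :: real)"
    using has_bochner_integral_real_indicator[of unit_box lborel] emeasure_unit_box
    by (simp add: measure_def)
  \<comment> \<open>\<open>Y\<close> is the squared deviation multiplied out into indicators, and
    \<open>V\<close> is its integral.\<close>
  define Y where "Y z = c ^ 2 * (\<Sum>u\<in>I. \<Sum>v\<in>I. indicator (S u \<inter> S v) z)
      - 2 * c * t * (\<Sum>u\<in>I. indicator (S u) z) + t ^ 2 * indicator unit_box z" for z :: "real \<times> real"
  define V where "V = c ^ 2 * (\<Sum>u\<in>I. \<Sum>v\<in>I. if D u = D v then q else q ^ 2)
      - 2 * c * t * (\<Sum>u\<in>I. q) + t ^ 2 * 1"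
  have Y: "has_bochner_integral lborel Y V"
    unfolding Y_def[abs_def] V_def
    by (intro has_bochner_integral_add has_bochner_integral_diff has_bochner_integral_mult_right
        has_bochner_integral_sum SS S box)
  have Y_eq: "(pair_corr (fst z) (snd z) s N A - 2 * s) ^ 2 * indicator unit_box z = Y z" for z
  proof (cases "z \<in> unit_box")
    case True
    define W where "W = (\<Sum>u\<in>I. indicator (S u) z :: real)"
    have "pair_corr (fst z) (snd z) s N A = c * W"
      unfolding pair_corr_eq_sum_strips[OF True] c_def W_def I_def S_def D_def ..
    moreover have "(\<Sum>u\<in>I. \<Sum>v\<in>I. indicator (S u \<inter> S v) z) = W * W"
      unfolding W_def sum_product indicator_inter_arith ..
    ultimately show ?thesis
      using True by (simp add: Y_def W_def[symmetric] t_def power2_eq_square algebra_simps)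
  next
    case False
    then have "z \<notin> S u" for u using strip_subset unfolding S_def by blast
    then have "indicator (S u) z = (0 :: real)" for u by simp
    then show ?thesis using False by (simp add: Y_def indicator_inter_arith)
  qed
  have Y_nonneg: "Y z \<ge> 0" for z unfolding Y_eq[symmetric] by simp
  have "(\<integral>\<^sup>+z. ennreal ((pair_corr (fst z) (snd z) s N A - 2 * s) ^ 2) * indicator unit_box z \<partial>lborel)
      = (\<integral>\<^sup>+z. ennreal (Y z) \<partial>lborel)"
    unfolding Y_eq[symmetric] by (intro nn_integral_cong) (simp split: split_indicator)
  also have "\<dots> = ennreal V"
    using Y Y_nonneg nn_integral_eq_integral[of lborel Y]
    by (auto simp: has_bochner_integral_iff)
  also have "V \<le> 2 * s * (real (diff_energy A N) / real N ^ 3) + 4 * s ^ 2 / real N ^ 2"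
  proof -
    \<comment> \<open>Adding \<open>q ^ 2\<close> also where the differences agree allows the other
      terms to be completed to a square.\<close>
    have "(\<Sum>u\<in>I. \<Sum>v\<in>I. if D u = D v then q else q ^ 2)
        \<le> (\<Sum>u\<in>I. \<Sum>v\<in>I. (if D v = D u then q else 0) + q ^ 2)"
      using q by (intro sum_mono) auto
    also have "\<dots> = real (diff_energy A N) * q + real (card I) ^ 2 * q ^ 2"
      unfolding diff_energy_eq_sum I_def[symmetric] D_def[symmetric]
      using fin by (simp add: sum.distrib sum_distrib_right power2_eq_square mult.assoc flip: sum.inter_filter)
    finally have "V \<le> c ^ 2 * (real (diff_energy A N) * q + real (card I) ^ 2 * q ^ 2)
        - 2 * c * t * (real (card I) * q) + t ^ 2"
      unfolding V_def by (simp add: mult_left_mono)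
    also have "\<dots> = c ^ 2 * q * real (diff_energy A N) + (c * real (card I) * q - t) ^ 2"
      by (simp add: power2_eq_square algebra_simps)
    \<comment> \<open>The \<open>N ^ 2 - N\<close> pairs give the mean
      \<open>2 * s * (N - 1) / N\<close>, which misses \<open>2 * s\<close> by
      \<open>2 * s / N\<close>.\<close>
    also have "c * real (card I) * q - t = - (2 * s / real N)"
    proof -
      have "N \<le> N ^ 2" by (simp add: power2_nat_le_imp_le self_le_power N)
      then have "real (card I) = real N ^ 2 - real N"
        unfolding I_def card_ordered_pairs by (simp add: of_nat_diff)
      then have "c * real (card I) = real N - 1"
        using N by (simp add: c_def field_simps power2_eq_square)
      then have "c * real (card I) * q - t = (real N - 1) * q - t" by simp
      also have "\<dots> = - (2 * s / real N)" using N by (simp add: q_def t_def field_simps)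
      finally show ?thesis .
    qed
    also have "c ^ 2 * q * real (diff_energy A N) + (- (2 * s / real N)) ^ 2
        = 2 * s * (real (diff_energy A N) / real N ^ 3) + 4 * s ^ 2 / real N ^ 2"
      using N by (simp add: c_def q_def power2_eq_square power3_eq_cube)
    finally show ?thesis .
  qed
  finally show ?thesis by (simp add: ennreal_leI)
qed

section \<open>Almost everywhere convergence along a sparse subsequence\<close>

text \<open>The sum of the squares has finite integral, so it is finite almost everywhere and its
  terms tend to 0. The offset \<open>k0\<close> allows for the initial terms, where
  \<open>s / N < 1 / 2\<close> may fail.\<close>

lemma AE_tendsto_of_summable_second_moment:
  fixes F :: "nat \<Rightarrow> 'a \<Rightarrow> real" and b :: "nat \<Rightarrow> real"
  assumes [measurable]: "\<And>k. F k \<in> borel_measurable M"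
    and bound: "\<And>k. k \<ge> k0 \<Longrightarrow> (\<integral>\<^sup>+z. ennreal ((F k z) ^ 2) \<partial>M) \<le> ennreal (b k)"
    and b: "summable b" "\<And>k. b k \<ge> 0"
  shows "AE z in M. (\<lambda>k. F k z) \<longlonglongrightarrow> 0"
proof -
  have "(\<integral>\<^sup>+z. (\<Sum>k. ennreal ((F (k + k0) z) ^ 2)) \<partial>M)
      = (\<Sum>k. \<integral>\<^sup>+z. ennreal ((F (k + k0) z) ^ 2) \<partial>M)"
    by (rule nn_integral_suminf) simp
  also have "\<dots> \<le> (\<Sum>k. ennreal (b (k + k0)))"
    by (intro suminf_le bound) auto
  also have "\<dots> = ennreal (\<Sum>k. b (k + k0))"
    using b by (intro suminf_ennreal2) (auto intro: summable_ignore_initial_segment)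
  also have "\<dots> < \<infinity>" by simp
  finally have "(\<integral>\<^sup>+z. (\<Sum>k. ennreal ((F (k + k0) z) ^ 2)) \<partial>M) \<noteq> \<infinity>" by simp
  then have "AE z in M. (\<Sum>k. ennreal ((F (k + k0) z) ^ 2)) \<noteq> \<infinity>"
    by (intro nn_integral_PInf_AE) auto
  then show ?thesis
  proof eventually_elim
    case (elim z)
    then have "summable (\<lambda>k. (F (k + k0) z) ^ 2)"
      by (intro summable_suminf_not_top) auto
    then have "(\<lambda>k. (F (k + k0) z) ^ 2) \<longlonglongrightarrow> 0" by (rule summable_LIMSEQ_zero)
    then have "(\<lambda>k. F (k + k0) z) \<longlonglongrightarrow> 0"
      by simp
    then show ?case by (rule LIMSEQ_offset)
  qed
qed

text \<open>The indices are chosen one after another, each beyond the last and far enough out; the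
  geometric bound makes the second moments summable.\<close>

lemma subseq_below_summable:
  fixes X :: "nat \<Rightarrow> real"
  assumes "X \<longlonglongrightarrow> 0"
  obtains r :: "nat \<Rightarrow> nat" where "strict_mono r" "\<And>k. X (r k) \<le> (1 / 2) ^ k"
proof -
  have ev: "\<exists>n > m. X n \<le> (1 / 2) ^ k" for m k
  proof -
    have "\<forall>\<^sub>F n in sequentially. X n < (1 / 2) ^ k"
      using assms by (rule order_tendstoD) simp
    then have "\<forall>\<^sub>F n in sequentially. n > m \<and> X n < (1 / 2) ^ k"
      using eventually_gt_at_top[of m] by eventually_elim auto
    then show ?thesis by (auto simp: eventually_sequentially intro: less_imp_le)
  qed
  have "\<exists>r. \<forall>k. X (r k) \<le> (1 / 2) ^ k \<and> r k < r (Suc k)"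
    by (rule dependent_nat_choice) (use ev in blast)+
  then obtain r where "\<And>k. X (r k) \<le> (1 / 2) ^ k" "\<And>k. r k < r (Suc k)" by blast
  then show thesis using that[of r] by (simp add: strict_mono_Suc_iff)
qed

lemma pair_corr_mono: "s \<le> s' \<Longrightarrow> pair_corr \<alpha> \<gamma> s N A \<le> pair_corr \<alpha> \<gamma> s' N A"
  unfolding pair_corr_def
proof (intro mult_left_mono of_nat_mono card_mono)
  assume "s \<le> s'"
  then have "s / real N \<le> s' / real N" by (rule divide_right_mono) simp
  then show "{(i, j). i \<in> {1..N} \<and> j \<in> {1..N} \<and> i \<noteq> j \<and>
       circle_norm (real (nth_elem A i) * \<alpha> - real (nth_elem A j) * \<alpha> - \<gamma>) \<le> s / real N}
     \<subseteq> {(i, j). i \<in> {1..N} \<and> j \<in> {1..N} \<and> i \<noteq> j \<and>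
       circle_norm (real (nth_elem A i) * \<alpha> - real (nth_elem A j) * \<alpha> - \<gamma>) \<le> s' / real N}"
    by auto
  show "finite {(i, j). i \<in> {1..N} \<and> j \<in> {1..N} \<and> i \<noteq> j \<and>
       circle_norm (real (nth_elem A i) * \<alpha> - real (nth_elem A j) * \<alpha> - \<gamma>) \<le> s' / real N}"
    by (rule finite_subset[of _ "{1..N} \<times> {1..N}"]) auto
qed simp

text \<open>Monotonicity squeezes the value at \<open>s\<close> between values at rationals on
  either side, whose limits come arbitrarily close to \<open>2 * s\<close>.\<close>

lemma tendsto_linear_of_rat:
  fixes G :: "nat \<Rightarrow> real \<Rightarrow> real"
  assumes mono: "\<And>k s s'. s \<le> s' \<Longrightarrow> G k s \<le> G k s'"
    and rat: "\<And>s. s \<in> \<rat> \<Longrightarrow> s > 0 \<Longrightarrow> (\<lambda>k. G k s) \<longlonglongrightarrow> 2 * s"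
    and s: "s > 0"
  shows "(\<lambda>k. G k s) \<longlonglongrightarrow> 2 * s"
proof (rule order_tendstoI)
  fix a assume "a < 2 * s"
  \<comment> \<open>The maximum with 0 keeps the rational \<open>q\<close> positive, as
    \<open>rat\<close> requires.\<close>
  then have "max 0 (a / 2) < s" using s by simp
  then obtain q where q: "q \<in> \<rat>" "max 0 (a / 2) < q" "q < s" using Rats_dense_in_real by blast
  then have "\<forall>\<^sub>F k in sequentially. a < G k q"
    by (intro order_tendstoD(1)[OF rat]) auto
  then show "\<forall>\<^sub>F k in sequentially. a < G k s"
    by eventually_elim (use mono[of q s] q in \<open>auto intro: less_le_trans\<close>)
next
  fix a assume "2 * s < a"
  then have "s < a / 2" by simp
  then obtain q where q: "q \<in> \<rat>" "s < q" "q < a / 2" using Rats_dense_in_real by blast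
  then have "\<forall>\<^sub>F k in sequentially. G k q < a"
    using s by (intro order_tendstoD(2)[OF rat]) auto
  then show "\<forall>\<^sub>F k in sequentially. G k s < a"
    by eventually_elim (use mono[of s q] q in \<open>auto intro: le_less_trans\<close>)
qed

text \<open>One subsequence serves every \<open>s\<close>: the moment bound is at most
  \<open>X\<close>, which does not involve \<open>s\<close>, times the constant
  \<open>2 * s + 4 * s ^ 2\<close>.\<close>

theorem doubly_metric_poissonian_subseq:
  fixes M :: "nat \<Rightarrow> nat"
  assumes M: "strict_mono M" "\<And>t. M t > 0"
    and energy: "(\<lambda>N. real (diff_energy A N) / real N ^ 3) \<longlonglongrightarrow> 0"
  obtains r :: "nat \<Rightarrow> nat" where "strict_mono r" "doubly_metric_poissonian_along A (M \<circ> r)"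
proof -
  define X where "X N = real (diff_energy A N) / real N ^ 3 + 1 / real N ^ 2" for N
  have "(\<lambda>N. 1 / real N ^ 2) \<longlonglongrightarrow> 0" by (simp add: tendsto_power_zero inverse_eq_divide lim_1_over_n flip: power_one_over)
  then have "X \<longlonglongrightarrow> 0" unfolding X_def using tendsto_add[OF energy] by fastforce
  then have "(\<lambda>t. X (M t)) \<longlonglongrightarrow> 0"
    using LIMSEQ_subseq_LIMSEQ[OF _ M(1), of X 0] by (simp add: o_def)
  then obtain r where r: "strict_mono r" and Xr: "\<And>k. X (M (r k)) \<le> (1 / 2) ^ k"
    by (rule subseq_below_summable) blast
  define L where "L k = M (r k)" for k
  have L: "L k > 0" for k using M(2) by (simp add: L_def)
  have "strict_mono L" using M(1) r unfolding L_def strict_mono_def by blast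
  then have L_lim: "filterlim (\<lambda>k. real (L k)) at_top sequentially"
    by (intro filterlim_compose[OF filterlim_real_sequentially] filterlim_subseq)
  have conv: "AE z in lborel. z \<in> unit_box \<longrightarrow> (\<lambda>k. pair_corr (fst z) (snd z) s (L k) A) \<longlonglongrightarrow> 2 * s"
    if s: "s > 0" for s
  proof -
    define F where "F k z = (pair_corr (fst z) (snd z) s (L k) A - 2 * s) * indicator unit_box z" for k z
    have meas: "F k \<in> borel_measurable lborel" for k
    proof -
      have "F k = (\<lambda>z. (1 / real (L k) * (\<Sum>u\<in>ordered_pairs (L k).
          indicator (strip (s / real (L k)) (elem_diff A u)) z) - 2 * s) * indicator unit_box z)"
      proof
        fix z
        show "F k z = (1 / real (L k) * (\<Sum>u\<in>ordered_pairs (L k).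
          indicator (strip (s / real (L k)) (elem_diff A u)) z) - 2 * s) * indicator unit_box z"
          by (cases "z \<in> unit_box") (simp_all add: F_def pair_corr_eq_sum_strips[of z])
      qed
      also have "\<dots> \<in> borel_measurable lborel" by measurable
      finally show ?thesis .
    qed
    \<comment> \<open>From \<open>k0\<close> on, \<open>s / L k < 1 / 2\<close>, as the variance
      bound requires.\<close>
    obtain k0 where k0: "\<And>k. k \<ge> k0 \<Longrightarrow> real (L k) > 2 * s"
      using filterlim_at_top_dense[THEN iffD1, OF L_lim] by (auto simp: eventually_sequentially)
    have bound: "(\<integral>\<^sup>+z. ennreal ((F k z) ^ 2) \<partial>lborel) \<le> ennreal ((2 * s + 4 * s ^ 2) * (1 / 2) ^ k)"
      if k: "k \<ge> k0" for k
    proof -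
      have "(\<integral>\<^sup>+z. ennreal ((F k z) ^ 2) \<partial>lborel)
        = (\<integral>\<^sup>+z. ennreal ((pair_corr (fst z) (snd z) s (L k) A - 2 * s) ^ 2) * indicator unit_box z \<partial>lborel)"
        by (intro nn_integral_cong) (auto simp: F_def split: split_indicator)
      also have "\<dots> \<le> ennreal (2 * s * (real (diff_energy A (L k)) / real (L k) ^ 3) + 4 * s ^ 2 / real (L k) ^ 2)"
        using s k0[OF k] L[of k] by (intro pair_corr_variance) (auto simp: field_simps)
      also have "\<dots> \<le> ennreal ((2 * s + 4 * s ^ 2) * (1 / 2) ^ k)"
      proof (rule ennreal_leI)
        \<comment> \<open>Both summands receive the common coefficient
          \<open>2 * s + 4 * s ^ 2\<close>, so that \<open>X\<close> factors out.\<close>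
        have "2 * s * (real (diff_energy A (L k)) / real (L k) ^ 3) + 4 * s ^ 2 * (1 / real (L k) ^ 2)
          \<le> (2 * s + 4 * s ^ 2) * (real (diff_energy A (L k)) / real (L k) ^ 3)
            + (2 * s + 4 * s ^ 2) * (1 / real (L k) ^ 2)"
          using s by (intro add_mono mult_right_mono) auto
        also have "\<dots> = (2 * s + 4 * s ^ 2) * X (L k)" by (simp add: X_def distrib_left)
        also have "\<dots> \<le> (2 * s + 4 * s ^ 2) * (1 / 2) ^ k"
          using Xr[of k] s by (intro mult_left_mono) (auto simp: L_def)
        finally show "2 * s * (real (diff_energy A (L k)) / real (L k) ^ 3) + 4 * s ^ 2 / real (L k) ^ 2
          \<le> (2 * s + 4 * s ^ 2) * (1 / 2) ^ k" by simp
      qed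
      finally show ?thesis .
    qed
    have "AE z in lborel. (\<lambda>k. F k z) \<longlonglongrightarrow> 0"
    proof (rule AE_tendsto_of_summable_second_moment[OF meas bound])
      show "summable (\<lambda>k. (2 * s + 4 * s ^ 2) * (1 / 2) ^ k)"
        by (intro summable_mult summable_geometric) simp
    qed (use s in auto)
    then show ?thesis
    proof eventually_elim
      case (elim z)
      then show ?case by (auto simp: F_def LIM_zero_cancel)
    qed
  qed
  \<comment> \<open>With \<open>s\<close> rational, only countably many exceptional null sets are
    united.\<close>
  have "AE z in lborel. \<forall>s\<in>{s \<in> \<rat>. s > 0}. z \<in> unit_box \<longrightarrow>
      (\<lambda>k. pair_corr (fst z) (snd z) s (L k) A) \<longlonglongrightarrow> 2 * s"
  proof (subst AE_ball_countable)
    show "countable {s :: real. s \<in> \<rat> \<and> s > 0}"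
      by (rule countable_subset[OF _ countable_rat]) blast
    show "\<forall>s\<in>{s \<in> \<rat>. s > 0}. AE z in lborel. z \<in> unit_box \<longrightarrow>
      (\<lambda>k. pair_corr (fst z) (snd z) s (L k) A) \<longlonglongrightarrow> 2 * s"
      using conv by blast
  qed
  then have "AE z in lborel. z \<in> unit_box \<longrightarrow>
      (\<forall>s>0. (\<lambda>k. pair_corr (fst z) (snd z) s (L k) A) \<longlonglongrightarrow> 2 * s)"
  proof eventually_elim
    case (elim z)
    show ?case
    proof (intro impI allI)
      fix s :: real assume z: "z \<in> unit_box" and s: "s > 0"
      show "(\<lambda>k. pair_corr (fst z) (snd z) s (L k) A) \<longlonglongrightarrow> 2 * s"
      proof (rule tendsto_linear_of_rat[where G = "\<lambda>k s. pair_corr (fst z) (snd z) s (L k) A", OF pair_corr_mono _ s])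
        fix q :: real assume "q \<in> \<rat>" "q > 0"
        then show "(\<lambda>k. pair_corr (fst z) (snd z) q (L k) A) \<longlonglongrightarrow> 2 * q" using elim z by blast
      qed
    qed
  qed
  \<comment> \<open>Borel null sets stay null for the completed measure, which the definition of the
    correlation property refers to.\<close>
  then have "AE z in lebesgue. z \<in> unit_box \<longrightarrow>
      (\<forall>s>0. (\<lambda>k. pair_corr (fst z) (snd z) s (L k) A) \<longlonglongrightarrow> 2 * s)"
    by (rule AE_completion)
  then have "doubly_metric_poissonian_along A (M \<circ> r)"
    unfolding doubly_metric_poissonian_along_def unit_box_def[symmetric]
    by (subst AE_restrict_space_iff) (auto simp: case_prod_beta L_def o_def)
  with r show thesis using that by blast
qed

theorem corollary2p5:
  fixes M :: "nat \<Rightarrow> nat"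
  assumes "strict_mono M" and "\<And>t. M t > 0"
  shows "\<exists>r :: nat \<Rightarrow> nat. strict_mono r \<and>
           doubly_metric_poissonian_along {p. prime p} (M \<circ> r)"
  by (rule doubly_metric_poissonian_subseq[OF assms diff_energy_primes]) blast

end
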